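(* There exists a universal constant $c>0$ such that the following holds. Let $h:[0,1]\to[0,1]$ be a concave function with $h(t)\ge Ent(t)$ for all $0\le t\le 1$. Then for every $n\ge 1$ and every Borel measurable function $f:[0,1]^n\to\{0,1\}$ with $\mathbb{E}f=p$, there exists $1\le k\le n$ such that $$I_f^h(k)\ \ge\ c\,p(1-p)\,\frac{\log n}{n}.$$
   Context: $[0,1]^n$ carries the Lebesgue measure $\lambda$, and expectations are with respect to it. $\log$ is the logarithm to base 2. $Ent(t)=-t\log t-(1-t)\log(1-t)$ for $0<t<1$, with $Ent(0)=Ent(1)=0$. For $f:[0,1]^n\to\{0,1\}$, $x\in[0,1]^n$ and $1\le k\le n$, let $f_k^x:[0,1]\to\{0,1\}$ be the restriction of $f$ to the fiber through $x$ in direction $k$: $f_k^x(t)=f(x_1,\ldots,x_{k-1},t,x_{k+1},\ldots,x_n)$. For $h:[0,1]\to[0,1]$, the $h$-influence of the $k$-th coordinate on $f$ is $I_f^h(k)=\mathbb{E}_{x\in[0,1]^n}\,h(\mathbb{E}f_k^x)$, where $\mathbb{E}f_k^x=\int_0^1 f_k^x(t)\,dt$. *)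

theory Defs
  imports "HOL-Analysis.Analysis"
begin

definition unit_interval :: "real measure" where
  "unit_interval = restrict_space lborel {0..1}"

text \<open>
  Points of the cube are extensional functions on the index set \<open>{1..n}\<close>, which allows the
  dimension \<open>n\<close> to be quantified. The measurable sets of the product are exactly the Borel sets
  of \<open>[0,1]^n\<close>, since the Borel sigma-algebra of the interval is countably generated.
\<close>

definition cube :: "nat \<Rightarrow> (nat \<Rightarrow> real) measure" where
  "cube n = PiM {1..n} (\<lambda>_. unit_interval)"

definition Ent :: "real \<Rightarrow> real" where
  "Ent t = (if 0 < t \<and> t < 1 then - t * log 2 t - (1 - t) * log 2 (1 - t) else 0)"

definition fiber :: "((nat \<Rightarrow> real) \<Rightarrow> real) \<Rightarrow> nat \<Rightarrow> (nat \<Rightarrow> real) \<Rightarrow> real \<Rightarrow> real" where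
  "fiber f k x = (\<lambda>t. f (x(k := t)))"

text \<open>
  For \<open>f\<close> measurable with values in \<open>{0,1}\<close> on the cube, and \<open>h\<close> concave on \<open>[0,1]\<close> with values
  in \<open>[0,1]\<close>, both integrands below are bounded and measurable (a concave function on an interval
  is continuous in its interior), so neither integral takes the default value of a
  non-integrable function.
\<close>

definition h_influence ::
  "(real \<Rightarrow> real) \<Rightarrow> nat \<Rightarrow> ((nat \<Rightarrow> real) \<Rightarrow> real) \<Rightarrow> nat \<Rightarrow> real" where
  "h_influence h n f k =
     (LINT x|cube n. h (LINT t|unit_interval. fiber f k x t))"

end

theory Submission
  imports Defs "HOL-Library.Nat_Bijection" "HOL-Probability.Probability_Measure"
begin

text \<open>
  Since \<open>Ent \<le> h\<close>, it is enough to treat \<open>h = Ent\<close>. Let \<open>J\<close> be the largest of the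
  \<open>Ent\<close>-influences of \<open>f\<close>. The proof turns \<open>f\<close> into a function of independent random bits whose
  influences are controlled by \<open>J\<close>, and then applies the inequality of Kahn, Kalai and Linial.

  \<^bold>\<open>From the cube to a grid.\<close> Dyadic cells generate the Borel sets, so \<open>f\<close> is close in mean to
  the indicator of a union of cells of side \<open>1 / 2 ^ m\<close> (\<open>approximable_all\<close>). As \<open>Ent\<close> is uniformly
  continuous, an error that is small in mean changes mean and influences only slightly
  (\<open>grid_entropy_approximation\<close>). What remains, up to an arbitrarily small error,
  is a statement about a set \<open>F\<close> of points of the grid \<open>{..<2 ^ m} ^ n\<close>.

  \<^bold>\<open>Making the set monotone.\<close> For two levels \<open>a < b\<close> of a coordinate \<open>k\<close>, sort the pair of values
  of the indicator of \<open>F\<close> at \<open>x(k := a)\<close> and \<open>x(k := b)\<close>. The fibres in direction \<open>k\<close> keep their sizes;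
  in any other direction two fibres \<open>A\<close>, \<open>B\<close> are replaced by \<open>A \<inter> B\<close> and \<open>A \<union> B\<close>, which does not
  increase the sum of a concave function of the fibre sizes. Repeating this leads to an upward closed
  set (\<open>monotone_rearrangement\<close>).

  \<^bold>\<open>From levels to bits.\<close> In an upward closed set every fibre is a final segment of \<open>{..<2 ^ m}\<close>.
  Write the levels in binary. Changing the \<open>j\<close>-th digit changes a level by \<open>2 ^ j\<close>, hence crosses the
  threshold of a segment with \<open>s\<close> elements from at most \<open>2 * min (2 ^ j) (min s (2 ^ m - s))\<close> levels.
  Summed over \<open>j\<close> and divided by \<open>2 ^ m\<close>, this is at most \<open>6 * Ent (s / 2 ^ m)\<close>, since for
  \<open>s \<le> 2 ^ m / 2\<close> about \<open>log 2 (2 ^ m / s)\<close> of the minima equal \<open>s\<close> and the others form a geometric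
  series (\<open>sum_tent_le_Ent\<close>). So the digits of one coordinate have total influence at most \<open>6 * J\<close>. This is
  where the rearrangement matters: the bit influences of a general set of levels are not bounded by the
  entropy of its density.

  \<^bold>\<open>The discrete inequality.\<close> Hence all \<open>n * m\<close> bit influences are at most \<open>6 * J\<close>, and their sum is
  at most \<open>6 * n * J\<close>. By Bonami's fourth moment bound the Walsh coefficients of low degree carry
  little weight if all influences are small, and those of high degree carry little weight because the
  total influence bounds the mean degree (\<open>KKL_inequality\<close>). With the degree cut at
  \<open>log 2 n / 16\<close> this gives \<open>p * (1 - p) \<le> 36 * n * J / log 2 n\<close> (\<open>log_bound_of_KKL\<close>).
\<close>

section \<open>Total influence on the discrete cube\<close>

text \<open>
  Points of the discrete cube with coordinates in a finite set \<open>V\<close> are encoded as subsets of \<open>V\<close>, the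
  coordinates equal to one. Both arguments of \<open>walsh\<close> then range over \<open>Pow V\<close>, and the function is
  symmetric in them, so that one orthogonality relation serves for rows and for columns.
\<close>

definition walsh :: "'v set \<Rightarrow> 'v set \<Rightarrow> real" where
  "walsh S X = (- 1) ^ card (S \<inter> X)"

definition cube_avg :: "'v set \<Rightarrow> ('v set \<Rightarrow> real) \<Rightarrow> real" where
  "cube_avg V g = (\<Sum>X\<in>Pow V. g X) / 2 ^ card V"

lemma cube_avg_cong:
  "(\<And>X. X \<subseteq> V \<Longrightarrow> f X = g X) \<Longrightarrow> cube_avg V f = cube_avg V g"
  unfolding cube_avg_def by (intro arg_cong2[where f="(/)"] sum.cong refl) auto

lemma cube_avg_nonneg:
  "(\<And>X. X \<subseteq> V \<Longrightarrow> 0 \<le> f X) \<Longrightarrow> 0 \<le> cube_avg V f"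
  unfolding cube_avg_def by (intro divide_nonneg_nonneg sum_nonneg) auto

lemma cube_avg_cmult: "cube_avg V (\<lambda>X. c * g X) = c * cube_avg V g"
  unfolding cube_avg_def by (simp add: sum_distrib_left)

lemma cube_avg_Cauchy_Schwarz:
  "(cube_avg V (\<lambda>X. f X * g X))\<^sup>2 \<le> cube_avg V (\<lambda>X. (f X)\<^sup>2) * cube_avg V (\<lambda>X. (g X)\<^sup>2)"
  using Cauchy_Schwarz_ineq_sum[of f g "Pow V"]
  unfolding cube_avg_def by (simp add: power_divide field_simps power2_eq_square)

lemma walsh_commute: "walsh S X = walsh X S"
  by (simp add: walsh_def Int_commute)

lemma walsh_insert:
  assumes "v \<notin> S" "finite S"
  shows "walsh (insert v S) X = (if v \<in> X then - walsh S X else walsh S X)"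
  using assms by (auto simp: walsh_def Int_insert_left)

lemma walsh_insert_right:
  assumes "v \<notin> X" "finite X"
  shows "walsh S (insert v X) = (if v \<in> S then - walsh S X else walsh S X)"
  using walsh_insert[OF assms, of S] by (simp add: walsh_commute)

lemma sum_Pow_insert:
  fixes g :: "'v set \<Rightarrow> 'b::comm_monoid_add"
  assumes "finite V" "v \<notin> V"
  shows "(\<Sum>X\<in>Pow (insert v V). g X) = (\<Sum>X\<in>Pow V. g X + g (insert v X))"
proof -
  have "(\<Sum>X\<in>Pow (insert v V). g X) = (\<Sum>X\<in>Pow V. g X) + (\<Sum>X\<in>insert v ` Pow V. g X)"
    unfolding Pow_insert using assms by (intro sum.union_disjoint) auto
  also have "(\<Sum>X\<in>insert v ` Pow V. g X) = (\<Sum>X\<in>Pow V. g (insert v X))"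
  proof (subst sum.reindex)
    show "inj_on (insert v) (Pow V)"
      using assms by (intro inj_onI) (metis PowD insert_ident subsetD)
  qed (simp add: o_def)
  finally show ?thesis by (simp add: sum.distrib)
qed

text \<open>
  Induction on \<open>V\<close>: the subsets with and without the new element \<open>v\<close> contribute the same sum, up to
  a sign that is negative if exactly one of \<open>X\<close> and \<open>Y\<close> contains \<open>v\<close>. The two contributions cancel in
  that case and double it otherwise.
\<close>

lemma walsh_orthogonal:
  assumes "finite V" "X \<subseteq> V" "Y \<subseteq> V"
  shows "(\<Sum>S\<in>Pow V. walsh S X * walsh S Y) = (if X = Y then 2 ^ card V else 0)"
  using assms
proof (induction V arbitrary: X Y rule: finite_induct)
  case empty
  then show ?case by (simp add: walsh_def)
next
  case (insert v V)
  let ?X = "X - {v}" and ?Y = "Y - {v}"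
  have XY: "?X \<subseteq> V" "?Y \<subseteq> V" using insert.prems by auto
  have *: "walsh S Z = walsh S (Z - {v})" if "S \<subseteq> V" for S and Z :: "'a set"
  proof -
    have "S \<inter> Z = S \<inter> (Z - {v})" using that insert.hyps by auto
    then show ?thesis by (simp add: walsh_def)
  qed
  have **: "walsh (insert v S) Z = (if v \<in> Z then -1 else 1) * walsh S (Z - {v})" if "S \<subseteq> V" for S and Z :: "'a set"
  proof -
    have "finite S" "v \<notin> S" using that insert.hyps finite_subset by auto
    then show ?thesis unfolding *[OF that, of Z, symmetric] by (simp add: walsh_insert)
  qed
  have "(\<Sum>S\<in>Pow (insert v V). walsh S X * walsh S Y)
     = (\<Sum>S\<in>Pow V. walsh S ?X * walsh S ?Y * (1 + (if v \<in> X then -1 else 1) * (if v \<in> Y then -1 else 1)))"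
    unfolding sum_Pow_insert[OF insert.hyps]
  proof (rule sum.cong[OF refl])
    fix S assume "S \<in> Pow V"
    then have S: "S \<subseteq> V" by simp
    show "walsh S X * walsh S Y + walsh (insert v S) X * walsh (insert v S) Y
      = walsh S ?X * walsh S ?Y * (1 + (if v \<in> X then -1 else 1) * (if v \<in> Y then -1 else 1))"
      unfolding **[OF S] *[OF S, of X] *[OF S, of Y] by (simp add: algebra_simps)
  qed
  also have "\<dots> = (1 + (if v \<in> X then -1 else 1) * (if v \<in> Y then -1 else 1)) * (if ?X = ?Y then 2 ^ card V else 0)"
    unfolding sum_distrib_right[symmetric] insert.IH[OF XY] by simp
  also have "\<dots> = (if X = Y then 2 ^ card (insert v V) else 0)"
    using insert.hyps by auto
  finally show ?case .
qed

definition walsh_coeff :: "'v set \<Rightarrow> ('v set \<Rightarrow> real) \<Rightarrow> 'v set \<Rightarrow> real" where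
  "walsh_coeff V f S = cube_avg V (\<lambda>X. f X * walsh S X)"

lemma walsh_expansion:
  assumes "finite V" "X \<subseteq> V"
  shows "f X = (\<Sum>S\<in>Pow V. walsh_coeff V f S * walsh S X)"
proof -
  have "(\<Sum>S\<in>Pow V. walsh_coeff V f S * walsh S X)
     = (\<Sum>S\<in>Pow V. \<Sum>Y\<in>Pow V. f Y * (walsh S Y * walsh S X)) / 2 ^ card V"
    unfolding walsh_coeff_def cube_avg_def times_divide_eq_left sum_divide_distrib[symmetric]
      sum_distrib_right by (simp only: mult.assoc)
  also have "(\<Sum>S\<in>Pow V. \<Sum>Y\<in>Pow V. f Y * (walsh S Y * walsh S X))
     = (\<Sum>Y\<in>Pow V. f Y * (\<Sum>S\<in>Pow V. walsh S Y * walsh S X))"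
    unfolding sum_distrib_left by (rule sum.swap)
  also have "\<dots> = (\<Sum>Y\<in>Pow V. if Y = X then f X * 2 ^ card V else 0)"
    by (intro sum.cong refl) (use assms in \<open>simp add: walsh_orthogonal\<close>)
  finally show ?thesis using assms by simp
qed

lemma parseval:
  assumes "finite V"
  shows "cube_avg V (\<lambda>X. (\<Sum>S\<in>Pow V. a S * walsh S X) * (\<Sum>S\<in>Pow V. b S * walsh S X))
       = (\<Sum>S\<in>Pow V. a S * b S)"
proof -
  have orth: "(\<Sum>X\<in>Pow V. walsh S X * walsh T X) = (if T = S then 2 ^ card V else 0)"
    if "S \<in> Pow V" "T \<in> Pow V" for S T
    using walsh_orthogonal[OF assms, of S T] that
    by (simp add: walsh_commute[of S] walsh_commute[of T] eq_commute[of S T])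
  have "(\<Sum>X\<in>Pow V. (\<Sum>S\<in>Pow V. a S * walsh S X) * (\<Sum>S\<in>Pow V. b S * walsh S X))
     = (\<Sum>X\<in>Pow V. \<Sum>S\<in>Pow V. \<Sum>T\<in>Pow V. a S * b T * (walsh S X * walsh T X))"
    unfolding sum_product by (intro sum.cong refl) (simp only: mult_ac)
  also have "\<dots> = (\<Sum>S\<in>Pow V. \<Sum>X\<in>Pow V. \<Sum>T\<in>Pow V. a S * b T * (walsh S X * walsh T X))"
    by (rule sum.swap)
  also have "\<dots> = (\<Sum>S\<in>Pow V. \<Sum>T\<in>Pow V. \<Sum>X\<in>Pow V. a S * b T * (walsh S X * walsh T X))"
    by (intro sum.cong refl sum.swap)
  also have "\<dots> = (\<Sum>S\<in>Pow V. \<Sum>T\<in>Pow V. if T = S then a S * b S * 2 ^ card V else 0)"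
    unfolding sum_distrib_left[symmetric] by (intro sum.cong refl) (simp add: orth)
  also have "\<dots> = (\<Sum>S\<in>Pow V. a S * b S) * 2 ^ card V"
    using assms by (simp add: sum_distrib_right)
  finally show ?thesis by (simp add: cube_avg_def)
qed

text \<open>
  Bonami's hypercontractive inequality in its fourth moment form. The weight \<open>3 ^ card S\<close> is what the
  induction requires: if the new variable enters as \<open>p \<plusminus> r\<close>, the average of the fourth powers is
  \<open>p ^ 4 + 6 * p\<^sup>2 * r\<^sup>2 + r ^ 4\<close>, and by Cauchy-Schwarz its mean is at most \<open>A\<^sup>2 + 6 * A * B + B\<^sup>2\<close>, which
  is below \<open>(A + 3 * B)\<^sup>2\<close>.
\<close>

lemma bonami:
  assumes "finite V"
  shows "cube_avg V (\<lambda>X. (\<Sum>S\<in>Pow V. b S * walsh S X) ^ 4)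
       \<le> (\<Sum>S\<in>Pow V. 3 ^ card S * (b S)\<^sup>2)\<^sup>2"
  using assms
proof (induction V arbitrary: b rule: finite_induct)
  case empty
  then show ?case by (simp add: cube_avg_def walsh_def)
next
  case (insert v V)
  define p where "p X = (\<Sum>S\<in>Pow V. b S * walsh S X)" for X
  define r where "r X = (\<Sum>S\<in>Pow V. b (insert v S) * walsh S X)" for X
  define A where "A = (\<Sum>S\<in>Pow V. 3 ^ card S * (b S)\<^sup>2)"
  define B where "B = (\<Sum>S\<in>Pow V. 3 ^ card S * (b (insert v S))\<^sup>2)"
  have AB: "A \<ge> 0" "B \<ge> 0" unfolding A_def B_def by (auto intro!: sum_nonneg)
  have fin: "finite X" "v \<notin> X" if "X \<subseteq> V" for X using that insert.hyps finite_subset by auto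
  have e1: "(\<Sum>S\<in>Pow (insert v V). b S * walsh S X) = p X + r X" if "X \<subseteq> V" for X
    unfolding sum_Pow_insert[OF insert.hyps] p_def r_def sum.distrib[symmetric]
    by (rule sum.cong) (use that fin in \<open>auto simp: walsh_insert subset_iff\<close>)
  have e2: "(\<Sum>S\<in>Pow (insert v V). b S * walsh S (insert v X)) = p X - r X" if "X \<subseteq> V" for X
    unfolding sum_Pow_insert[OF insert.hyps] p_def r_def sum_subtractf[symmetric]
    by (rule sum.cong) (use that fin in \<open>auto simp: walsh_insert walsh_insert_right\<close>)
  have pA: "cube_avg V (\<lambda>X. p X ^ 4) \<le> A\<^sup>2" unfolding p_def A_def by (rule insert.IH)
  have rB: "cube_avg V (\<lambda>X. r X ^ 4) \<le> B\<^sup>2" unfolding r_def B_def by (rule insert.IH)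
  have pr: "cube_avg V (\<lambda>X. (p X)\<^sup>2 * (r X)\<^sup>2) \<le> A * B"
  proof (rule power2_le_imp_le)
    have "(cube_avg V (\<lambda>X. (p X)\<^sup>2 * (r X)\<^sup>2))\<^sup>2
      \<le> cube_avg V (\<lambda>X. p X ^ 4) * cube_avg V (\<lambda>X. r X ^ 4)"
      using cube_avg_Cauchy_Schwarz[of V "\<lambda>X. (p X)\<^sup>2" "\<lambda>X. (r X)\<^sup>2"] by simp
    also have "\<dots> \<le> A\<^sup>2 * B\<^sup>2"
      using pA rB by (intro mult_mono) (auto simp: cube_avg_def intro!: sum_nonneg divide_nonneg_nonneg)
    finally show "(cube_avg V (\<lambda>X. (p X)\<^sup>2 * (r X)\<^sup>2))\<^sup>2 \<le> (A * B)\<^sup>2"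
      by (simp add: power_mult_distrib)
  qed (use AB in simp)
  have "cube_avg (insert v V) (\<lambda>X. (\<Sum>S\<in>Pow (insert v V). b S * walsh S X) ^ 4)
    = (\<Sum>X\<in>Pow V. (p X + r X) ^ 4 + (p X - r X) ^ 4) / (2 * 2 ^ card V)"
    unfolding cube_avg_def sum_Pow_insert[OF insert.hyps, of "\<lambda>X. _ X ^ 4"]
    using insert.hyps by (simp add: e1 e2)
  also have "\<dots> = (\<Sum>X\<in>Pow V. 2 * (p X ^ 4 + 6 * ((p X)\<^sup>2 * (r X)\<^sup>2) + r X ^ 4)) / (2 * 2 ^ card V)"
    by (intro arg_cong2[where f="(/)"] refl sum.cong) (simp add: power4_eq_xxxx power2_eq_square algebra_simps)
  also have "\<dots> = cube_avg V (\<lambda>X. p X ^ 4) + 6 * cube_avg V (\<lambda>X. (p X)\<^sup>2 * (r X)\<^sup>2) + cube_avg V (\<lambda>X. r X ^ 4)"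
    unfolding cube_avg_def sum_distrib_left[symmetric] sum.distrib by (simp add: field_simps)
  also have "\<dots> \<le> A\<^sup>2 + 6 * (A * B) + B\<^sup>2" using pA rB pr by simp
  also have "\<dots> \<le> (A + 3 * B)\<^sup>2" by (simp add: power2_eq_square algebra_simps)
  also have "A + 3 * B = (\<Sum>S\<in>Pow (insert v V). 3 ^ card S * (b S)\<^sup>2)"
    unfolding sum_Pow_insert[OF insert.hyps] A_def B_def sum_distrib_left sum.distrib[symmetric]
    by (rule sum.cong) (use fin in auto)
  finally show ?case .
qed

definition flip :: "'v \<Rightarrow> 'v set \<Rightarrow> 'v set" where
  "flip v X = (if v \<in> X then X - {v} else insert v X)"

definition bit_influence :: "'v set \<Rightarrow> ('v set \<Rightarrow> real) \<Rightarrow> 'v \<Rightarrow> real" where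
  "bit_influence V f v = cube_avg V (\<lambda>X. of_bool (f X \<noteq> f (flip v X)))"

lemma walsh_flip:
  assumes "finite X"
  shows "walsh S (flip v X) = (if v \<in> S then - walsh S X else walsh S X)"
proof (cases "v \<in> X")
  case True
  then have "X = insert v (X - {v})" by auto
  then have "walsh S X = (if v \<in> S then - walsh S (X - {v}) else walsh S (X - {v}))"
    by (metis walsh_insert_right DiffD2 assms finite_Diff singletonI)
  then show ?thesis using True by (auto simp: flip_def)
qed (use assms in \<open>auto simp: flip_def walsh_insert_right\<close>)

text \<open>
  The discrete derivative in direction \<open>v\<close> keeps the part of the expansion whose characters change
  sign under \<open>flip v\<close>.
\<close>

lemma derivative_expansion:
  assumes "finite V" "v \<in> V" "X \<subseteq> V"
  shows "(f X - f (flip v X)) / 2 = (\<Sum>S\<in>Pow V. (if v \<in> S then walsh_coeff V f S else 0) * walsh S X)"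
proof -
  have X: "finite X" "flip v X \<subseteq> V" using assms finite_subset by (auto simp: flip_def)
  have "f X - f (flip v X) = (\<Sum>S\<in>Pow V. walsh_coeff V f S * walsh S X - walsh_coeff V f S * walsh S (flip v X))"
    using walsh_expansion[OF assms(1,3), of f] walsh_expansion[OF assms(1) X(2), of f]
    by (simp add: sum_subtractf)
  also have "\<dots> = (\<Sum>S\<in>Pow V. 2 * ((if v \<in> S then walsh_coeff V f S else 0) * walsh S X))"
    by (intro sum.cong refl) (simp add: walsh_flip X)
  finally show ?thesis by (simp add: sum_distrib_left[symmetric])
qed

text \<open>
  Let \<open>g\<close> be the part of degree at most \<open>d\<close> of the derivative \<open>D\<close> in direction \<open>v\<close>, so that the weight
  \<open>w\<close> is the mean of \<open>g * D\<close>. As \<open>\<bar>D\<bar>\<close> is half the indicator \<open>N\<close> of the points at which \<open>v\<close> is pivotal,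
  applying Cauchy-Schwarz twice bounds \<open>w\<close> by a power of the influence times the fourth moment of \<open>g\<close>.
  Bonami's inequality bounds the fourth moment by \<open>(3 ^ d * w)\<^sup>2\<close>, and solving for \<open>w\<close> leaves the
  influence to the power \<open>3 / 2\<close>. The exponent above one is the gain over the trivial bound.
\<close>

lemma low_degree_weight:
  assumes V: "finite V" "v \<in> V" and f01: "\<And>X. X \<subseteq> V \<Longrightarrow> f X \<in> {0, 1}"
    and w_def: "w = (\<Sum>S\<in>{S\<in>Pow V. v \<in> S \<and> card S \<le> d}. (walsh_coeff V f S)\<^sup>2)"
  shows "4 * w \<le> 3 ^ d * (bit_influence V f v * sqrt (bit_influence V f v))"
proof -
  define P where "P = bit_influence V f v"
  define b where "b S = (if v \<in> S \<and> card S \<le> d then walsh_coeff V f S else 0)" for S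
  define g where "g X = (\<Sum>S\<in>Pow V. b S * walsh S X)" for X
  define D where "D X = (f X - f (flip v X)) / 2" for X
  define N where "N X = (of_bool (f X \<noteq> f (flip v X)) :: real)" for X
  have P0: "P \<ge> 0" unfolding P_def bit_influence_def by (intro cube_avg_nonneg) auto
  have w: "w = (\<Sum>S\<in>Pow V. (b S)\<^sup>2)"
    unfolding w_def b_def using V by (intro sum.mono_neutral_cong_left) auto
  have w0: "w \<ge> 0" unfolding w by (intro sum_nonneg) auto
  have fl: "flip v X \<subseteq> V" if "X \<subseteq> V" for X using that V by (auto simp: flip_def)
  have D: "D X = (\<Sum>S\<in>Pow V. (if v \<in> S then walsh_coeff V f S else 0) * walsh S X)" if "X \<subseteq> V" for X
    unfolding D_def using derivative_expansion[OF V that] .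
  have "cube_avg V (\<lambda>X. g X * D X) = (\<Sum>S\<in>Pow V. b S * (if v \<in> S then walsh_coeff V f S else 0))"
    unfolding g_def by (rule trans[OF cube_avg_cong parseval[OF V(1)]]) (simp add: D)
  also have "\<dots> = w" unfolding w by (intro sum.cong refl) (auto simp: b_def power2_eq_square)
  finally have w1: "w = cube_avg V (\<lambda>X. g X * D X)" ..
  have "2 * w = cube_avg V (\<lambda>X. N X * (2 * D X * g X))"
    unfolding w1 cube_avg_def times_divide_eq_right sum_distrib_left
    by (intro arg_cong2[where f="(/)"] sum.cong refl) (simp add: N_def D_def)
  then have w2: "(2 * w)\<^sup>2 \<le> cube_avg V (\<lambda>X. (N X)\<^sup>2) * cube_avg V (\<lambda>X. (2 * D X * g X)\<^sup>2)"
    by (simp only: cube_avg_Cauchy_Schwarz)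
  have NP: "cube_avg V (\<lambda>X. (N X)\<^sup>2) = P"
    unfolding P_def bit_influence_def by (intro cube_avg_cong) (auto simp: N_def)
  have DD: "(2 * D X * g X)\<^sup>2 = N X * (g X)\<^sup>2" if "X \<subseteq> V" for X
    using f01[OF that] f01[OF fl[OF that]] by (auto simp: D_def N_def)
  have "(cube_avg V (\<lambda>X. N X * (g X)\<^sup>2))\<^sup>2 \<le> P * cube_avg V (\<lambda>X. ((g X)\<^sup>2)\<^sup>2)"
    unfolding NP[symmetric] by (rule cube_avg_Cauchy_Schwarz)
  also have "cube_avg V (\<lambda>X. ((g X)\<^sup>2)\<^sup>2) = cube_avg V (\<lambda>X. g X ^ 4)" by simp
  also have "\<dots> \<le> (\<Sum>S\<in>Pow V. 3 ^ card S * (b S)\<^sup>2)\<^sup>2"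
    unfolding g_def by (rule bonami[OF V(1)])
  also have "\<dots> \<le> (3 ^ d * w)\<^sup>2"
  proof (intro power_mono)
    show "(\<Sum>S\<in>Pow V. 3 ^ card S * (b S)\<^sup>2) \<le> 3 ^ d * w"
      unfolding w sum_distrib_left by (intro sum_mono) (auto simp: b_def intro!: mult_right_mono power_increasing)
  qed (auto intro!: sum_nonneg)
  finally have g4: "(cube_avg V (\<lambda>X. N X * (g X)\<^sup>2))\<^sup>2 \<le> P * (3 ^ d * w)\<^sup>2" using P0 by (simp add: mult_left_mono)
  \<comment> \<open>The two applications of Cauchy-Schwarz, \<open>w2\<close> and \<open>g4\<close>, are chained: \<open>2 * D\<close> is a sign where \<open>v\<close>
      is pivotal and vanishes elsewhere.\<close>
  have "(2 * w)\<^sup>2 \<le> P * cube_avg V (\<lambda>X. N X * (g X)\<^sup>2)"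
  proof -
    have "cube_avg V (\<lambda>X. (2 * D X * g X)\<^sup>2) = cube_avg V (\<lambda>X. N X * (g X)\<^sup>2)"
      by (rule cube_avg_cong) (rule DD)
    then show ?thesis using w2 unfolding NP by simp
  qed
  also have "\<dots> \<le> P * (sqrt P * (3 ^ d * w))"
    using g4 P0 w0 by (intro mult_left_mono power2_le_imp_le[OF g4[THEN order_trans]]) (auto simp: power_mult_distrib)
  finally have "w * (4 * w) \<le> w * (3 ^ d * (P * sqrt P))" by (simp add: power2_eq_square algebra_simps)
  then have "4 * w \<le> 3 ^ d * (P * sqrt P)"
    using w0 P0 by (cases "w = 0") auto
  then show ?thesis unfolding P_def .
qed

lemma total_influence:
  assumes V: "finite V" and f01: "\<And>X. X \<subseteq> V \<Longrightarrow> f X \<in> {0, 1}"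
  shows "(\<Sum>v\<in>V. bit_influence V f v) = 4 * (\<Sum>S\<in>Pow V. real (card S) * (walsh_coeff V f S)\<^sup>2)"
proof -
  have "bit_influence V f v = 4 * (\<Sum>S\<in>Pow V. if v \<in> S then (walsh_coeff V f S)\<^sup>2 else 0)" if v: "v \<in> V" for v
  proof -
    have "bit_influence V f v = 4 * cube_avg V (\<lambda>X. (f X - f (flip v X)) / 2 * ((f X - f (flip v X)) / 2))"
      unfolding bit_influence_def cube_avg_cmult[symmetric]
    proof (rule cube_avg_cong)
      fix X assume "X \<subseteq> V"
      then have "X \<subseteq> V" "flip v X \<subseteq> V" using v by (auto simp: flip_def)
      then have "f X \<in> {0,1}" "f (flip v X) \<in> {0,1}" using f01 by blast+
      then show "of_bool (f X \<noteq> f (flip v X)) = 4 * ((f X - f (flip v X)) / 2 * ((f X - f (flip v X)) / 2))"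
        by auto
    qed
    also have "cube_avg V (\<lambda>X. (f X - f (flip v X)) / 2 * ((f X - f (flip v X)) / 2))
      = (\<Sum>S\<in>Pow V. (if v \<in> S then walsh_coeff V f S else 0) * (if v \<in> S then walsh_coeff V f S else 0))"
      by (rule trans[OF cube_avg_cong parseval[OF V]]) (simp add: derivative_expansion[OF V v])
    also have "\<dots> = (\<Sum>S\<in>Pow V. if v \<in> S then (walsh_coeff V f S)\<^sup>2 else 0)"
      by (intro sum.cong) (auto simp: power2_eq_square)
    finally show ?thesis .
  qed
  then have "(\<Sum>v\<in>V. bit_influence V f v) = 4 * (\<Sum>v\<in>V. \<Sum>S\<in>Pow V. if v \<in> S then (walsh_coeff V f S)\<^sup>2 else 0)"
    by (simp add: sum_distrib_left)
  also have "\<dots> = 4 * (\<Sum>S\<in>Pow V. real (card S) * (walsh_coeff V f S)\<^sup>2)"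
  proof (subst sum.swap, intro arg_cong2[where f="(*)"] sum.cong refl)
    fix S assume "S \<in> Pow V"
    then have "V \<inter> S = S" by auto
    then show "(\<Sum>v\<in>V. if v \<in> S then (walsh_coeff V f S)\<^sup>2 else 0) = real (card S) * (walsh_coeff V f S)\<^sup>2"
      using V by (simp add: sum.If_cases)
  qed
  finally show ?thesis .
qed

text \<open>
  The variance is the weight of the nonempty characters. Those of degree at most \<open>d\<close> are charged to
  each of their elements and estimated by \<open>low_degree_weight\<close>; those of degree above \<open>d\<close> have weight
  at most \<open>1 / (d + 1)\<close> times the sum of the squared coefficients weighted by degree, which is a
  quarter of the total influence (\<open>total_influence\<close>).
\<close>

lemma KKL_inequality:
  assumes V: "finite V" and f01: "\<And>X. X \<subseteq> V \<Longrightarrow> f X \<in> {0, 1}"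
    and le: "\<And>v. v \<in> V \<Longrightarrow> bit_influence V f v \<le> \<delta>"
  shows "4 * (cube_avg V f * (1 - cube_avg V f))
       \<le> (\<Sum>v\<in>V. bit_influence V f v) * (3 ^ d * sqrt \<delta> + 1 / real (d + 1))"
proof -
  define a where "a S = (walsh_coeff V f S)\<^sup>2" for S
  define I where "I v = bit_influence V f v" for v
  have a0: "a S \<ge> 0" for S unfolding a_def by simp
  have I0: "I v \<ge> 0" for v unfolding I_def bit_influence_def by (intro cube_avg_nonneg) auto
  have "cube_avg V f = cube_avg V (\<lambda>X. f X * f X)"
    by (intro cube_avg_cong) (use f01 in force)
  also have "\<dots> = (\<Sum>S\<in>Pow V. a S)"
    unfolding a_def power2_eq_square
    by (rule trans[OF cube_avg_cong parseval[OF V]]) (simp add: walsh_expansion[OF V, symmetric])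
  finally have q: "cube_avg V f = (\<Sum>S\<in>Pow V. a S)" .
  have "walsh_coeff V f {} = cube_avg V f" by (simp add: walsh_coeff_def walsh_def)
  then have a_empty: "a {} = (cube_avg V f)\<^sup>2" by (simp add: a_def)
  have "cube_avg V f * (1 - cube_avg V f) = (\<Sum>S\<in>Pow V. a S) - a {}"
    unfolding a_empty q[symmetric] by (simp add: power2_eq_square algebra_simps)
  also have "\<dots> = (\<Sum>S\<in>Pow V - {{}}. a S)" using V by (subst sum_diff1) auto
  also have "\<dots> \<le> (\<Sum>S\<in>Pow V. (\<Sum>v\<in>V. if v \<in> S \<and> card S \<le> d then a S else 0) + real (card S) * a S / real (d + 1))"
  proof (rule order_trans[OF sum_mono sum_mono2])
    fix S assume S: "S \<in> Pow V - {{}}"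
    then obtain u where u: "u \<in> S" "u \<in> V" by auto
    show "a S \<le> (\<Sum>v\<in>V. if v \<in> S \<and> card S \<le> d then a S else 0) + real (card S) * a S / real (d + 1)"
    proof (cases "card S \<le> d")
      case True
      have "a S \<le> (\<Sum>v\<in>V. if v \<in> S \<and> card S \<le> d then a S else 0)"
        using member_le_sum[OF u(2), of "\<lambda>v. if v \<in> S \<and> card S \<le> d then a S else 0"] V a0 u True by auto
      then show ?thesis using a0[of S] by (simp add: add_increasing2)
    next
      case False
      then have "real (d + 1) * a S \<le> real (card S) * a S" using a0 by (intro mult_right_mono) auto
      then show ?thesis using False by (simp add: field_simps)
    qed
  qed (use V a0 in \<open>auto intro!: add_nonneg_nonneg sum_nonneg\<close>)
  also have "\<dots> = (\<Sum>v\<in>V. \<Sum>S\<in>{S\<in>Pow V. v \<in> S \<and> card S \<le> d}. a S) + (\<Sum>S\<in>Pow V. real (card S) * a S) / real (d + 1)"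
  proof -
    have "(\<Sum>S\<in>Pow V. \<Sum>v\<in>V. if v \<in> S \<and> card S \<le> d then a S else 0)
        = (\<Sum>v\<in>V. \<Sum>S\<in>Pow V. if v \<in> S \<and> card S \<le> d then a S else 0)"
      by (rule sum.swap)
    also have "\<dots> = (\<Sum>v\<in>V. \<Sum>S\<in>{S\<in>Pow V. v \<in> S \<and> card S \<le> d}. a S)"
      using V by (intro sum.cong refl sum.inter_filter[symmetric]) auto
    finally show ?thesis by (simp add: sum.distrib sum_divide_distrib)
  qed
  finally have "4 * (cube_avg V f * (1 - cube_avg V f)) \<le> (\<Sum>v\<in>V. 4 * (\<Sum>S\<in>{S\<in>Pow V. v \<in> S \<and> card S \<le> d}. a S))
      + 4 * (\<Sum>S\<in>Pow V. real (card S) * a S) / real (d + 1)"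
    unfolding sum_distrib_left[symmetric] times_divide_eq_right[symmetric] by linarith
  also have "4 * (\<Sum>S\<in>Pow V. real (card S) * a S) = (\<Sum>v\<in>V. I v)"
    unfolding a_def I_def by (rule total_influence[OF V f01, symmetric])
  also have "(\<Sum>v\<in>V. 4 * (\<Sum>S\<in>{S\<in>Pow V. v \<in> S \<and> card S \<le> d}. a S)) \<le> (\<Sum>v\<in>V. I v * (3 ^ d * sqrt \<delta>))"
  proof (rule sum_mono)
    fix v assume v: "v \<in> V"
    have "4 * (\<Sum>S\<in>{S\<in>Pow V. v \<in> S \<and> card S \<le> d}. a S) \<le> 3 ^ d * (I v * sqrt (I v))"
      unfolding a_def I_def by (rule low_degree_weight[OF V v f01 refl])
    also have "\<dots> \<le> 3 ^ d * (I v * sqrt \<delta>)"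
      using le[OF v] I0[of v] by (intro mult_left_mono) (auto simp: I_def)
    finally show "4 * (\<Sum>S\<in>{S\<in>Pow V. v \<in> S \<and> card S \<le> d}. a S) \<le> I v * (3 ^ d * sqrt \<delta>)"
      by (simp add: algebra_simps)
  qed
  finally show ?thesis unfolding I_def sum_distrib_right[symmetric] by (simp add: algebra_simps)
qed

section \<open>Monotone rearrangement on a grid\<close>

abbreviation grid :: "'k set \<Rightarrow> nat \<Rightarrow> ('k \<Rightarrow> nat) set" where
  "grid K M \<equiv> (\<Pi>\<^sub>E k\<in>K. {..<M})"

definition fiber_count :: "nat \<Rightarrow> ('k \<Rightarrow> nat) set \<Rightarrow> 'k \<Rightarrow> ('k \<Rightarrow> nat) \<Rightarrow> nat" where
  "fiber_count M F k x = card {a. a < M \<and> x(k := a) \<in> F}"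

definition grid_influence :: "'k set \<Rightarrow> nat \<Rightarrow> (nat \<Rightarrow> real) \<Rightarrow> ('k \<Rightarrow> nat) set \<Rightarrow> 'k \<Rightarrow> real" where
  "grid_influence K M \<phi> F k = (\<Sum>x\<in>grid K M. \<phi> (fiber_count M F k x))"

text \<open>
  Concavity for arguments of the same sum. This is the form in which it meets
  \<open>card (A \<inter> B) + card (A \<union> B) = card A + card B\<close>.
\<close>

definition nat_concave :: "(nat \<Rightarrow> real) \<Rightarrow> bool" where
  "nat_concave \<phi> \<longleftrightarrow> (\<forall>u a b v. u \<le> a \<longrightarrow> u \<le> b \<longrightarrow> a + b = u + v \<longrightarrow> \<phi> u + \<phi> v \<le> \<phi> a + \<phi> b)"

text \<open>
  On every pair of points that differ only in the levels \<open>a\<close> and \<open>b\<close> of coordinate \<open>k\<close>, membership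
  in \<open>F\<close> is moved from level \<open>a\<close> to level \<open>b\<close> whenever there is room: level \<open>a\<close> receives the conjunction
  and level \<open>b\<close> the disjunction.
\<close>

definition compress :: "'k \<Rightarrow> nat \<Rightarrow> nat \<Rightarrow> ('k \<Rightarrow> nat) set \<Rightarrow> ('k \<Rightarrow> nat) set" where
  "compress k a b F = {x. if x k = a then x \<in> F \<and> x(k := b) \<in> F
                          else if x k = b then x \<in> F \<or> x(k := a) \<in> F else x \<in> F}"

lemma grid_upd: "x \<in> grid K M \<Longrightarrow> k \<in> K \<Longrightarrow> a < M \<Longrightarrow> x(k := a) \<in> grid K M"
  by (auto simp: PiE_iff extensional_def)

lemma compress_subset_grid:
  assumes "F \<subseteq> grid K M" "k \<in> K" "b < M"
  shows "compress k a b F \<subseteq> grid K M"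
proof
  fix x assume x: "x \<in> compress k a b F"
  show "x \<in> grid K M"
  proof (cases "x k = b \<and> x(k := a) \<in> F")
    case True
    then have "x(k := a) \<in> grid K M" using assms by auto
    then have "(x(k := a))(k := b) \<in> grid K M" by (rule grid_upd[OF _ assms(2,3)])
    moreover have "(x(k := a))(k := b) = x" using True by auto
    ultimately show ?thesis by simp
  next
    case False
    then show ?thesis using x assms by (auto simp: compress_def split: if_splits)
  qed
qed

definition swap_level :: "'k \<Rightarrow> nat \<Rightarrow> nat \<Rightarrow> ('k \<Rightarrow> nat) \<Rightarrow> ('k \<Rightarrow> nat)" where
  "swap_level k a b x = x(k := if x k = a then b else if x k = b then a else x k)"

lemma swap_level_simps:
  "x k = a \<Longrightarrow> swap_level k a b x = x(k := b)"
  "x k = b \<Longrightarrow> swap_level k a b x = x(k := a)"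
  "x k \<noteq> a \<Longrightarrow> x k \<noteq> b \<Longrightarrow> swap_level k a b x = x"
  by (auto simp: swap_level_def)

lemma bij_swap_level:
  assumes "k \<in> K" "a < M" "b < M"
  shows "bij_betw (swap_level k a b) (grid K M) (grid K M)"
proof (rule bij_betw_byWitness[where f' = "swap_level k a b"])
  show "swap_level k a b ` grid K M \<subseteq> grid K M"
    using assms by (auto simp: swap_level_def PiE_iff extensional_def)
  then show "swap_level k a b ` grid K M \<subseteq> grid K M" .
qed (auto simp: swap_level_def)

text \<open>
  Used to compare sums over the grid before and after a compression: it suffices to compare the
  contributions of the two points of each swapped pair.
\<close>

lemma sum_swap_level:
  fixes g :: "('k \<Rightarrow> nat) \<Rightarrow> real"
  assumes "k \<in> K" "a < M" "b < M"
  shows "2 * (\<Sum>x\<in>grid K M. g x) = (\<Sum>x\<in>grid K M. g x + g (swap_level k a b x))"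
  using sum.reindex_bij_betw[OF bij_swap_level[OF assms], of g] by (simp add: sum.distrib)

text \<open>
  A fibre \<open>A\<close> in direction \<open>j\<close> at level \<open>a\<close> of coordinate \<open>k\<close> and the corresponding fibre \<open>B\<close> at level
  \<open>b\<close> become \<open>A \<inter> B\<close> and \<open>A \<union> B\<close>. Their sizes have the same sum and are further apart.
\<close>

lemma grid_influence_compress_other:
  assumes \<phi>: "nat_concave \<phi>" and k: "k \<in> K" "a < M" "b < M" and jk: "j \<noteq> k"
  shows "grid_influence K M \<phi> (compress k a b F) j \<le> grid_influence K M \<phi> F j"
proof (cases "a = b")
  case True
  then have "compress k a b F = F" by (auto simp: compress_def fun_upd_idem)
  then show ?thesis by simp
next
  case ab: False
  have *: "\<phi> (fiber_count M (compress k a b F) j x) + \<phi> (fiber_count M (compress k a b F) j (x(k := b)))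
      \<le> \<phi> (fiber_count M F j x) + \<phi> (fiber_count M F j (x(k := b)))" if "x k = a" for x
  proof -
    define A where "A = {c. c < M \<and> x(j := c) \<in> F}"
    define B where "B = {c. c < M \<and> x(j := c, k := b) \<in> F}"
    have fin: "finite A" "finite B" unfolding A_def B_def by auto
    have tw: "x(k := b, j := c) = x(j := c, k := b)" "x(j := c, k := a) = x(j := c)" for c
      using jk that by (auto simp: fun_eq_iff)
    have 1: "{c. c < M \<and> x(j := c) \<in> compress k a b F} = A \<inter> B"
      using that jk by (auto simp: compress_def A_def B_def)
    have 2: "{c. c < M \<and> x(k := b, j := c) \<in> compress k a b F} = A \<union> B"
      using that jk ab unfolding tw by (auto simp: compress_def A_def B_def tw)
    have 3: "{c. c < M \<and> x(k := b, j := c) \<in> F} = B"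
      unfolding tw B_def ..
    show ?thesis
      unfolding fiber_count_def 1 2 3 A_def[symmetric]
      using \<phi> card_Un_Int[OF fin] card_mono[OF fin(1), of "A \<inter> B"] card_mono[OF fin(2), of "A \<inter> B"]
      unfolding nat_concave_def by auto
  qed
  have "2 * grid_influence K M \<phi> (compress k a b F) j \<le> 2 * grid_influence K M \<phi> F j"
    unfolding grid_influence_def sum_swap_level[OF k]
  proof (rule sum_mono)
    fix x assume "x \<in> grid K M"
    consider "x k = a" | "x k = b" | "x k \<noteq> a" "x k \<noteq> b" by blast
    then show "\<phi> (fiber_count M (compress k a b F) j x) + \<phi> (fiber_count M (compress k a b F) j (swap_level k a b x))
      \<le> \<phi> (fiber_count M F j x) + \<phi> (fiber_count M F j (swap_level k a b x))"
    proof cases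
      case 1
      then show ?thesis using *[of x] 1 by (simp add: swap_level_simps)
    next
      case 2
      then have "x(k := a, k := b) = x" by auto
      with 2 show ?thesis using *[of "x(k := a)"] by (simp add: swap_level_simps)
    next
      case 3
      then have "{c. c < M \<and> x(j := c) \<in> compress k a b F} = {c. c < M \<and> x(j := c) \<in> F}"
        using jk by (auto simp: compress_def)
      with 3 show ?thesis by (simp add: swap_level_simps fiber_count_def)
    qed
  qed
  then show ?thesis by simp
qed

lemma fiber_count_compress_same:
  assumes "a < M" "b < M"
  shows "fiber_count M (compress k a b F) k x = fiber_count M F k x"
proof -
  define S where "S = {c. c < M \<and> x(k := c) \<in> F}"
  have *: "{c. c < M \<and> x(k := c) \<in> compress k a b F} =
     {c. c < M \<and> (if c = a then a \<in> S \<and> b \<in> S else if c = b then a \<in> S \<or> b \<in> S else c \<in> S)}"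
    using assms by (auto simp: compress_def S_def)
  have "finite S" unfolding S_def by auto
  show ?thesis
  proof (cases "a \<in> S \<and> b \<notin> S")
    case True
    then have eq: "{c. c < M \<and> (if c = a then a \<in> S \<and> b \<in> S else if c = b then a \<in> S \<or> b \<in> S else c \<in> S)}
        = insert b (S - {a})"
      using assms by (auto simp: S_def)
    have "card (insert b (S - {a})) = Suc (card (S - {a}))"
      using True \<open>finite S\<close> by simp
    also have "\<dots> = card S" using True \<open>finite S\<close> by (intro card_Suc_Diff1) auto
    finally have "card {c. c < M \<and> x(k := c) \<in> compress k a b F} = card S"
      unfolding * eq .
    then show ?thesis unfolding fiber_count_def S_def[symmetric] .
  next
    case False
    then have "{c. c < M \<and> x(k := c) \<in> compress k a b F} = S"
      unfolding * using assms by (auto simp: S_def split: if_splits)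
    then show ?thesis unfolding fiber_count_def S_def[symmetric] by simp
  qed
qed

lemma sum_indicator_grid:
  assumes "finite K" "F \<subseteq> grid K M"
  shows "(\<Sum>x\<in>grid K M. of_bool (x \<in> F) * w x) = (\<Sum>x\<in>F. w x :: real)"
proof -
  have "finite (grid K M)" using assms by (auto intro: finite_PiE)
  then have "(\<Sum>x\<in>grid K M. of_bool (x \<in> F) * w x) = (\<Sum>x\<in>grid K M \<inter> F. w x)"
    unfolding sum.inter_restrict[OF \<open>finite (grid K M)\<close>] by (intro sum.cong refl) simp
  also have "grid K M \<inter> F = F" using assms by auto
  finally show ?thesis .
qed

lemma compress_in_iff:
  assumes "a \<noteq> b"
  shows "x k = a \<Longrightarrow> x \<in> compress k a b F \<longleftrightarrow> x \<in> F \<and> x(k := b) \<in> F"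
    and "x k = a \<Longrightarrow> x(k := b) \<in> compress k a b F \<longleftrightarrow> x \<in> F \<or> x(k := b) \<in> F"
  using assms by (auto simp: compress_def fun_upd_idem)

lemma card_compress:
  assumes K: "finite K" "F \<subseteq> grid K M" and k: "k \<in> K" "a < M" "b < M" "a \<noteq> b"
  shows "card (compress k a b F) = card F"
proof -
  have eq: "of_bool (x \<in> compress k a b F) + of_bool (swap_level k a b x \<in> compress k a b F)
      = (of_bool (x \<in> F) + of_bool (swap_level k a b x \<in> F) :: real)" for x
  proof -
    consider "x k = a" | "x k = b" | "x k \<noteq> a" "x k \<noteq> b" by blast
    then show ?thesis
    proof cases
      case 1
      then show ?thesis using compress_in_iff[OF k(4), of x k F] by (auto simp: swap_level_simps)
    next
      case 2
      then have "x(k := a, k := b) = x" by auto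
      then show ?thesis using 2 compress_in_iff[OF k(4), of "x(k := a)" k F] by (auto simp: swap_level_simps)
    qed (simp add: swap_level_simps compress_def)
  qed
  have "2 * (\<Sum>x\<in>grid K M. of_bool (x \<in> compress k a b F)) = 2 * (\<Sum>x\<in>grid K M. of_bool (x \<in> F) :: real)"
    unfolding sum_swap_level[OF k(1-3)] eq ..
  then show ?thesis
    using sum_indicator_grid[OF K, of "\<lambda>_. 1"]
      sum_indicator_grid[OF K(1) compress_subset_grid[OF K(2) k(1,3), of a], of "\<lambda>_. 1"] by simp
qed

text \<open>
  A potential that every compression with an effect increases.
\<close>

definition height :: "'k set \<Rightarrow> ('k \<Rightarrow> nat) set \<Rightarrow> real" where
  "height K F = (\<Sum>x\<in>F. \<Sum>k\<in>K. real (x k))"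

lemma height_compress:
  assumes K: "finite K" "F \<subseteq> grid K M" and k: "k \<in> K" "a < b" "b < M"
    and y: "y \<in> F" "y k = a" "y(k := b) \<notin> F"
  shows "height K F < height K (compress k a b F)"
proof -
  define w where "w x = (\<Sum>k\<in>K. real (x k))" for x :: "'a \<Rightarrow> nat"
  have ab: "a \<noteq> b" "a < M" using k by auto
  have w: "w x + real b - real a = w (x(k := b))" if "x k = a" for x
    using K(1) k(1) that by (simp add: w_def sum.remove[of K k])
  have *: "of_bool (x \<in> F) * w x + of_bool (x(k := b) \<in> F) * w (x(k := b))
     \<le> of_bool (x \<in> compress k a b F) * w x + of_bool (x(k := b) \<in> compress k a b F) * w (x(k := b))"
    if "x k = a" for x
    using compress_in_iff[OF ab(1), of x k F] w[of x] that k(2) by auto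
  have "2 * (\<Sum>x\<in>grid K M. of_bool (x \<in> F) * w x) < 2 * (\<Sum>x\<in>grid K M. of_bool (x \<in> compress k a b F) * w x)"
    unfolding sum_swap_level[OF k(1) ab(2) k(3)]
  proof (rule sum_strict_mono_ex1)
    show "finite (grid K M)" using K(1) by (auto intro: finite_PiE)
    show "\<forall>x\<in>grid K M. of_bool (x \<in> F) * w x + of_bool (swap_level k a b x \<in> F) * w (swap_level k a b x)
      \<le> of_bool (x \<in> compress k a b F) * w x + of_bool (swap_level k a b x \<in> compress k a b F) * w (swap_level k a b x)"
    proof
      fix x
      consider "x k = a" | "x k = b" | "x k \<noteq> a" "x k \<noteq> b" by blast
      then show "of_bool (x \<in> F) * w x + of_bool (swap_level k a b x \<in> F) * w (swap_level k a b x)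
      \<le> of_bool (x \<in> compress k a b F) * w x + of_bool (swap_level k a b x \<in> compress k a b F) * w (swap_level k a b x)"
      proof cases
        case 1
        then show ?thesis using *[of x] 1 by (simp add: swap_level_simps)
      next
        case 2
        then have "x(k := a, k := b) = x" by auto
        then show ?thesis using 2 *[of "x(k := a)"] by (simp add: swap_level_simps)
      qed (simp add: swap_level_simps compress_def)
    qed
    show "\<exists>x\<in>grid K M. of_bool (x \<in> F) * w x + of_bool (swap_level k a b x \<in> F) * w (swap_level k a b x)
      < of_bool (x \<in> compress k a b F) * w x + of_bool (swap_level k a b x \<in> compress k a b F) * w (swap_level k a b x)"
    proof (rule bexI[of _ y])
      show "y \<in> grid K M" using y K by auto
      show "of_bool (y \<in> F) * w y + of_bool (swap_level k a b y \<in> F) * w (swap_level k a b y)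
      < of_bool (y \<in> compress k a b F) * w y + of_bool (swap_level k a b y \<in> compress k a b F) * w (swap_level k a b y)"
        using y(1,3) compress_in_iff[OF ab(1), of y k F] w[of y] k(2) by (simp add: swap_level_simps y(2))
    qed
  qed
  then show ?thesis
    unfolding height_def w_def[symmetric] sum_indicator_grid[OF K]
      sum_indicator_grid[OF K(1) compress_subset_grid[OF K(2) k(1,3)]] by simp
qed

text \<open>
  Among the finitely many sets of the same size whose influences do not exceed those of \<open>F\<close>, take one
  of maximal height. If it were not upward closed, a compression would produce a higher one.
\<close>

lemma monotone_rearrangement:
  assumes K: "finite K" and F: "F \<subseteq> grid K M" and \<phi>: "nat_concave \<phi>"
  obtains H where "H \<subseteq> grid K M" "card H = card F"
    "\<And>k. k \<in> K \<Longrightarrow> grid_influence K M \<phi> H k \<le> grid_influence K M \<phi> F k"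
    "\<And>k x b. k \<in> K \<Longrightarrow> x \<in> H \<Longrightarrow> x k < b \<Longrightarrow> b < M \<Longrightarrow> x(k := b) \<in> H"
proof -
  define C where "C = {H. H \<subseteq> grid K M \<and> card H = card F \<and>
    (\<forall>k\<in>K. grid_influence K M \<phi> H k \<le> grid_influence K M \<phi> F k)}"
  have "C \<subseteq> Pow (grid K M)" unfolding C_def by auto
  moreover have "finite (grid K M)" using K by (auto intro: finite_PiE)
  ultimately have "finite C" by (meson finite_Pow_iff finite_subset)
  moreover have "F \<in> C" using F by (simp add: C_def)
  ultimately have "Max (height K ` C) \<in> height K ` C" by (intro Max_in) auto
  then obtain H where H: "H \<in> C" and "height K H = Max (height K ` C)" by auto
  then have max: "height K H' \<le> height K H" if "H' \<in> C" for H'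
    using that \<open>finite C\<close> by simp
  show ?thesis
  proof (rule that)
    show "x(k := b) \<in> H" if k: "k \<in> K" and x: "x \<in> H" "x k < b" and b: "b < M" for k x b
    proof (rule ccontr)
      assume "x(k := b) \<notin> H"
      have HG: "H \<subseteq> grid K M" using H by (simp add: C_def)
      have "compress k (x k) b H \<in> C"
        unfolding C_def
      proof (intro CollectI conjI ballI)
        show "compress k (x k) b H \<subseteq> grid K M" by (rule compress_subset_grid[OF HG k b])
        show "card (compress k (x k) b H) = card F"
          using card_compress[OF K HG k, of "x k" b] H x b by (simp add: C_def)
        fix j assume j: "j \<in> K"
        have "grid_influence K M \<phi> (compress k (x k) b H) j \<le> grid_influence K M \<phi> H j"
        proof (cases "j = k")
          case True
          have "x k < M" using x b by simp
          then show ?thesis using True by (simp add: grid_influence_def fiber_count_compress_same b)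
        next
          case False
          then show ?thesis using x b by (intro grid_influence_compress_other[OF \<phi> k]) auto
        qed
        also have "\<dots> \<le> grid_influence K M \<phi> F j" using H j by (simp add: C_def)
        finally show "grid_influence K M \<phi> (compress k (x k) b H) j \<le> grid_influence K M \<phi> F j" .
      qed
      moreover have "height K H < height K (compress k (x k) b H)"
        by (rule height_compress[OF K HG k x(2) b x(1) refl]) fact
      ultimately show False using max by force
    qed
  qed (use H in \<open>auto simp: C_def\<close>)
qed

section \<open>Binary digits\<close>

text \<open>
  A point of the discrete cube with coordinates \<open>K \<times> {..<m}\<close> lists the binary digits of the levels of a
  grid point.
\<close>

definition decode :: "'k set \<Rightarrow> ('k \<times> nat) set \<Rightarrow> 'k \<Rightarrow> nat" where
  "decode K X = (\<lambda>k\<in>K. set_encode {j. (k, j) \<in> X})"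

lemma set_encode_less:
  assumes "A \<subseteq> {..<m}"
  shows "set_encode A < 2 ^ m"
proof -
  have "set_encode A \<le> (\<Sum>i<m. 2 ^ i)"
    unfolding set_encode_def using assms by (intro sum_mono2) auto
  also have "\<dots> < (2::nat) ^ m" by (induction m) auto
  finally show ?thesis .
qed

lemma set_decode_subset:
  assumes "a < 2 ^ m"
  shows "set_decode a \<subseteq> {..<m}"
proof
  fix j assume "j \<in> set_decode a"
  then have "a div 2 ^ j \<noteq> 0" by (intro notI) (simp add: set_decode_def)
  then have "2 ^ j \<le> a" by (simp add: div_eq_0_iff)
  then have "(2::nat) ^ j < 2 ^ m" using assms by linarith
  then show "j \<in> {..<m}" by simp
qed

lemma slice_subset: "X \<subseteq> K \<times> {..<m} \<Longrightarrow> {j. (k, j) \<in> X} \<subseteq> {..<m}"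
  by auto

lemma decode_in_grid: "X \<subseteq> K \<times> {..<m} \<Longrightarrow> decode K X \<in> grid K (2 ^ m)"
  using slice_subset[of X K m] by (auto simp: decode_def set_encode_less)

lemma bij_decode: "bij_betw (decode K) (Pow (K \<times> {..<m})) (grid K (2 ^ m))"
proof (rule bij_betw_byWitness[where f' = "\<lambda>x. {(k, j). k \<in> K \<and> j \<in> set_decode (x k)}"])
  show "\<forall>X\<in>Pow (K \<times> {..<m}). {(k, j). k \<in> K \<and> j \<in> set_decode (decode K X k)} = X"
  proof
    fix X assume X: "X \<in> Pow (K \<times> {..<m})"
    then have "finite {j. (k, j) \<in> X}" for k
      using slice_subset[of X K m k] finite_subset by auto
    then show "{(k, j). k \<in> K \<and> j \<in> set_decode (decode K X k)} = X"
      using X by (auto simp: decode_def)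
  qed
  show "\<forall>x\<in>grid K (2 ^ m). decode K {(k, j). k \<in> K \<and> j \<in> set_decode (x k)} = x"
    by (auto simp: decode_def fun_eq_iff PiE_iff extensional_def)
  show "decode K ` Pow (K \<times> {..<m}) \<subseteq> grid K (2 ^ m)"
    using decode_in_grid by blast
  show "(\<lambda>x. {(k, j). k \<in> K \<and> j \<in> set_decode (x k)}) ` grid K (2 ^ m) \<subseteq> Pow (K \<times> {..<m})"
    using set_decode_subset by (force simp: PiE_iff)
qed

lemma decode_insert:
  assumes "X \<subseteq> K \<times> {..<m}" "k \<in> K" "(k, j) \<notin> X"
  shows "decode K (insert (k, j) X) = (decode K X)(k := decode K X k + 2 ^ j)"
proof -
  have fin: "finite {i. (k, i) \<in> X}" using slice_subset[OF assms(1), of k] finite_subset by auto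
  have "{i. i = j \<or> (k, i) \<in> X} = insert j {i. (k, i) \<in> X}" by auto
  then have "set_encode {i. i = j \<or> (k, i) \<in> X} = 2 ^ j + set_encode {i. (k, i) \<in> X}"
    using fin assms(3) by (simp add: set_encode_insert)
  then show ?thesis using assms(2) by (auto simp: decode_def fun_eq_iff)
qed

lemma sum_grid_insert:
  fixes u :: "('k \<Rightarrow> nat) \<Rightarrow> real"
  assumes "finite K" "k \<in> K"
  shows "(\<Sum>x\<in>grid K M. u x) = (\<Sum>y\<in>grid (K - {k}) M. \<Sum>a<M. u (y(k := a)))"
proof -
  have "(\<Sum>x\<in>grid (insert k (K - {k})) M. u x)
      = (\<Sum>(a, y)\<in>{..<M} \<times> grid (K - {k}) M. u (y(k := a)))"
    unfolding PiE_insert_eq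
    by (subst sum.reindex[OF inj_combinator]) (auto simp: case_prod_unfold)
  also have "\<dots> = (\<Sum>a<M. \<Sum>y\<in>grid (K - {k}) M. u (y(k := a)))"
    by (rule sum.cartesian_product[symmetric])
  also have "\<dots> = (\<Sum>y\<in>grid (K - {k}) M. \<Sum>a<M. u (y(k := a)))"
    by (rule sum.swap)
  finally show ?thesis using assms by (simp add: insert_absorb)
qed

lemma sum_grid_resample:
  fixes u :: "('k \<Rightarrow> nat) \<Rightarrow> real"
  assumes "finite K" "k \<in> K"
  shows "real M * (\<Sum>x\<in>grid K M. u x) = (\<Sum>x\<in>grid K M. \<Sum>a<M. u (x(k := a)))"
  unfolding sum_grid_insert[OF assms] by (simp add: sum_distrib_left)

text \<open>
  A fibre of an upward closed set is the final segment of its size.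
\<close>

lemma upper_fiber:
  assumes up: "\<And>x b. x \<in> H \<Longrightarrow> x k < b \<Longrightarrow> b < M \<Longrightarrow> x(k := b) \<in> H"
  assumes a: "a < M"
  shows "x(k := a) \<in> H \<longleftrightarrow> M - fiber_count M H k x \<le> a"
proof -
  define S where "S = {a. a < M \<and> x(k := a) \<in> H}"
  have upS: "b \<in> S" if "c \<in> S" "c < b" "b < M" for b c
    using up[of "x(k := c)" b] that by (simp add: S_def)
  have S: "S \<subseteq> {..<M}" by (auto simp: S_def)
  have "a \<in> S \<longleftrightarrow> M - card S \<le> a"
  proof
    assume "a \<in> S"
    then have "{a..<M} \<subseteq> S" using upS by (auto simp: le_less)
    then have "M - a \<le> card S" using card_mono[OF finite_subset[OF S], of "{a..<M}"] by simp
    then show "M - card S \<le> a" by linarith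
  next
    assume le: "M - card S \<le> a"
    show "a \<in> S"
    proof (rule ccontr)
      assume "a \<notin> S"
      have "S \<subseteq> {Suc a..<M}"
      proof
        fix c assume c: "c \<in> S"
        then have "\<not> c < a" "c \<noteq> a" using upS[OF c _ a] \<open>a \<notin> S\<close> by auto
        then show "c \<in> {Suc a..<M}" using c S by auto
      qed
      then have "card S \<le> M - Suc a" using card_mono[of "{Suc a..<M}" S] by simp
      then show False using le a by linarith
    qed
  qed
  then show ?thesis using a by (simp add: S_def fiber_count_def)
qed

text \<open>
  The levels \<open>a < M\<close> from which a step by \<open>2 ^ j\<close>, upwards in the first set and downwards in the second,
  stays in \<open>{..<M}\<close> and crosses the threshold \<open>t\<close> of the final segment \<open>{t..<M}\<close>. The digit of \<open>a\<close>
  decides which of the two steps is taken; counting both costs a constant factor.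
\<close>

definition crossing :: "nat \<Rightarrow> nat \<Rightarrow> nat \<Rightarrow> nat set" where
  "crossing M j t = {a. a < t \<and> t \<le> a + 2 ^ j \<and> a + 2 ^ j < M} \<union> {a. t \<le> a \<and> a < t + 2 ^ j \<and> 2 ^ j \<le> a \<and> a < M}"

lemma card_crossing:
  assumes "t \<le> M"
  shows "card (crossing M j t) \<le> 2 * min (2 ^ j) (min (M - t) t)"
proof -
  let ?A = "{a. a < t \<and> t \<le> a + 2 ^ j \<and> a + 2 ^ j < M}"
  let ?B = "{a. t \<le> a \<and> a < t + 2 ^ j \<and> 2 ^ j \<le> a \<and> a < M}"
  have "?A \<subseteq> {t - 2 ^ j..<t}" by auto
  from card_mono[OF _ this] have A1: "card ?A \<le> 2 ^ j" by simp
  have A2: "card ?A \<le> t" using card_mono[of "{..<t}" ?A] by auto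
  have "(\<lambda>a. a + 2 ^ j) ` ?A \<subseteq> {t..<M}" by auto
  from card_inj_on_le[OF _ this] have A3: "card ?A \<le> M - t" by (simp add: inj_on_def)
  have "?B \<subseteq> {t..<t + 2 ^ j}" by auto
  from card_mono[OF _ this] have B1: "card ?B \<le> 2 ^ j" by simp
  have "?B \<subseteq> {t..<M}" by auto
  from card_mono[OF _ this] have B2: "card ?B \<le> M - t" by simp
  have "(\<lambda>a. a - 2 ^ j) ` ?B \<subseteq> {..<t}" by auto
  moreover have "inj_on (\<lambda>a. a - 2 ^ j) ?B" by (auto simp: inj_on_def)
  ultimately have B3: "card ?B \<le> t" using card_inj_on_le[of _ ?B "{..<t}"] by simp
  have "card (crossing M j t) \<le> card ?A + card ?B"
    unfolding crossing_def by (rule card_Un_le)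
  also have "card ?A \<le> min (2 ^ j) (min (M - t) t)" using A1 A2 A3 by simp
  also have "card ?B \<le> min (2 ^ j) (min (M - t) t)" using B1 B2 B3 by simp
  finally show ?thesis by simp
qed

text \<open>
  Half the bound for the influence of digit \<open>j\<close> on a final segment of density \<open>q\<close>. It is concave in
  \<open>q\<close>, so the rearrangement does not increase its mean over the fibres.
\<close>

definition tent :: "nat \<Rightarrow> nat \<Rightarrow> real \<Rightarrow> real" where
  "tent m j q = min (2 ^ j / 2 ^ m) (min q (1 - q))"

text \<open>
  The influence of a digit is computed by averaging over the fibres in direction \<open>k\<close>: in each of them
  the pivotal levels belong to a \<open>crossing\<close> set, whose size depends only on the size of the fibre.
\<close>

lemma bit_influence_decode:
  assumes K: "finite K" "k \<in> K" and j: "j < m" and H: "H \<subseteq> grid K (2 ^ m)"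
    and up: "\<And>x b. x \<in> H \<Longrightarrow> x k < b \<Longrightarrow> b < 2 ^ m \<Longrightarrow> x(k := b) \<in> H"
  shows "bit_influence (K \<times> {..<m}) (\<lambda>X. of_bool (decode K X \<in> H)) (k, j)
    \<le> 2 * (\<Sum>x\<in>grid K (2 ^ m). tent m j (fiber_count (2 ^ m) H k x / 2 ^ m)) / real (2 ^ m) ^ card K"
proof -
  define M where "M = (2::nat) ^ m"
  define s where "s x = fiber_count M H k x" for x
  have sM: "s x \<le> M" for x
    unfolding s_def fiber_count_def using card_mono[of "{..<M}" "{a. a < M \<and> x(k := a) \<in> H}"] by auto
  define C where "C x = crossing M j (M - s x)" for x
  have mem: "y \<in> H \<longleftrightarrow> M - s y \<le> y k" if "y k < M" for y
    using upper_fiber[where H = H and k = k and M = M and x = y and a = "y k"] up that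
    by (simp add: s_def M_def)
  have s_upd: "s (x(k := a)) = s x" for x a by (simp add: s_def fiber_count_def)
  have flip_cross: "decode K X k \<in> C (decode K X)"
    if X: "X \<subseteq> K \<times> {..<m}" and ne: "(decode K X \<in> H) \<noteq> (decode K (flip (k, j) X) \<in> H)" for X
  proof -
    have X': "flip (k, j) X \<subseteq> K \<times> {..<m}" using X K j by (auto simp: flip_def)
    have less: "decode K X k < M" "decode K (flip (k, j) X) k < M"
      using decode_in_grid[OF X] decode_in_grid[OF X'] K unfolding M_def by (auto simp: PiE_iff)
    show ?thesis
    proof (cases "(k, j) \<in> X")
      case False
      then have f: "decode K (flip (k, j) X) = (decode K X)(k := decode K X k + 2 ^ j)"
        using decode_insert[OF X K(2)] by (simp add: flip_def)
      show ?thesis using ne less mem[of "decode K X"] mem[of "decode K (flip (k, j) X)"]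
        by (auto simp: f s_upd C_def crossing_def)
    next
      case True
      then have "decode K (insert (k, j) (flip (k, j) X))
          = (decode K (flip (k, j) X))(k := decode K (flip (k, j) X) k + 2 ^ j)"
        by (intro decode_insert[OF X' K(2)]) (simp add: flip_def)
      also have "insert (k, j) (flip (k, j) X) = X" using True by (auto simp: flip_def)
      finally have f: "decode K X = (decode K (flip (k, j) X))(k := decode K (flip (k, j) X) k + 2 ^ j)" .
      then have "s (decode K X) = s (decode K (flip (k, j) X))" "decode K X k = decode K (flip (k, j) X) k + 2 ^ j"
        by (simp_all add: s_upd)
      then show ?thesis using ne less mem[of "decode K X"] mem[of "decode K (flip (k, j) X)"]
        by (auto simp: C_def crossing_def)
    qed
  qed
  have bound: "(\<Sum>a<M. of_bool (a \<in> C x)) \<le> real M * (2 * tent m j (real (s x) / real M))" for x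
  proof -
    have "(\<Sum>a<M. of_bool (a \<in> C x)) = real (card {a. a < M \<and> a \<in> C x})"
      by (simp add: sum.If_cases of_bool_def Int_def)
    also have "\<dots> \<le> real (card (C x))"
      by (intro of_nat_mono card_mono) (auto simp: C_def crossing_def)
    also have "\<dots> \<le> real (2 * min (2 ^ j) (min (M - (M - s x)) (M - s x)))"
      unfolding C_def by (intro of_nat_mono card_crossing) simp
    also have "\<dots> = 2 * min (2 ^ j) (min (real (s x)) (real M - real (s x)))"
      using sM[of x] by (simp add: of_nat_min of_nat_diff)
    also have "\<dots> = real M * (2 * tent m j (real (s x) / real M))"
    proof -
      have "real M > 0" by (simp add: M_def)
      then show ?thesis
        by (simp add: tent_def min_mult_distrib_left right_diff_distrib) (simp add: M_def)
    qed
    finally show ?thesis .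
  qed
  have card_V: "card (K \<times> {..<m}) = m * card K" by (simp add: card_cartesian_product)
  have "(\<Sum>X\<in>Pow (K \<times> {..<m}). of_bool ((of_bool (decode K X \<in> H) :: real) \<noteq> of_bool (decode K (flip (k, j) X) \<in> H)) :: real)
      \<le> (\<Sum>X\<in>Pow (K \<times> {..<m}). of_bool (decode K X k \<in> C (decode K X)))"
    by (intro sum_mono) (use flip_cross in auto)
  also have "\<dots> = (\<Sum>x\<in>grid K M. of_bool (x k \<in> C x))"
    unfolding M_def by (rule sum.reindex_bij_betw[OF bij_decode])
  also have "real M * \<dots> = (\<Sum>x\<in>grid K M. \<Sum>a<M. of_bool (a \<in> C x))"
    unfolding sum_grid_resample[OF K] by (simp add: C_def s_upd)
  also have "\<dots> \<le> (\<Sum>x\<in>grid K M. real M * (2 * tent m j (real (s x) / real M)))"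
    by (intro sum_mono bound)
  also have "\<dots> = real M * (2 * (\<Sum>x\<in>grid K M. tent m j (real (s x) / real M)))"
    by (simp add: sum_distrib_left)
  finally have "(\<Sum>X\<in>Pow (K \<times> {..<m}). of_bool ((of_bool (decode K X \<in> H) :: real) \<noteq> of_bool (decode K (flip (k, j) X) \<in> H)) :: real)
      \<le> 2 * (\<Sum>x\<in>grid K M. tent m j (real (s x) / real M))"
    by (simp add: M_def mult_le_cancel_left)
  then show ?thesis
    unfolding bit_influence_def cube_avg_def card_V s_def M_def
    by (simp add: divide_right_mono power_mult[symmetric])
qed

text \<open>
  The first \<open>r\<close> terms are estimated by \<open>q\<close>, the remaining ones by the geometric series.
\<close>

lemma sum_min_geometric:
  fixes q :: real
  assumes "0 \<le> q"
  shows "(\<Sum>i<m. min (1 / 2 ^ Suc i) q) \<le> real (min m r) * q + 1 / 2 ^ r - 1 / 2 ^ (max m r)"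
proof (induction m)
  case (Suc m)
  show ?case
  proof (cases "m < r")
    case True
    then have "(\<Sum>i<m. min (1 / 2 ^ Suc i) q) \<le> real m * q" using Suc by (simp add: max_def min_def)
    moreover have "min (1 / 2 ^ Suc m) q \<le> q" by simp
    moreover have "min (Suc m) r = Suc m" "max (Suc m) r = r" using True by auto
    ultimately show ?thesis by (simp add: algebra_simps)
  next
    case False
    then have "min (Suc m) r = r" "max (Suc m) r = Suc m" "min m r = r" "max m r = m" by auto
    moreover have "min (1 / 2 ^ Suc m) q \<le> 1 / 2 ^ m - 1 / 2 ^ Suc m" by (simp add: field_simps)
    ultimately show ?thesis using Suc by simp
  qed
qed simp

lemma Ent_sym: "Ent (1 - q) = Ent q"
  by (auto simp: Ent_def algebra_simps)

lemma Ent_lower: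
  assumes "0 < q" "q \<le> 1/2"
  shows "q * log 2 (1 / q) \<le> Ent q"
proof -
  have "(1 - q) * log 2 (1 - q) \<le> 0"
    using assms by (intro mult_nonneg_nonpos) auto
  then show ?thesis using assms by (simp add: Ent_def log_divide)
qed

text \<open>
  Cutting the sum at \<open>r = \<lceil>log 2 (1 / q)\<rceil>\<close> balances the two bounds of \<open>sum_min_geometric\<close>:
  \<open>r * q + 1 / 2 ^ r \<le> q * log 2 (1 / q) + 2 * q\<close>. For \<open>q \<le> 1 / 2\<close> the logarithm is at least one and
  absorbs the second term.
\<close>

lemma sum_tent_le_Ent_half:
  assumes "0 < q" "q \<le> 1/2"
  shows "(\<Sum>j<m. tent m j q) \<le> 3 * Ent q"
proof -
  define L where "L = log 2 (1 / q)"
  define r where "r = nat \<lceil>L\<rceil>"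
  have L1: "1 \<le> L" unfolding L_def using assms by (subst le_log_iff) (auto simp: field_simps)
  then have r: "L \<le> real r" "real r \<le> L + 1" unfolding r_def by linarith+
  have "1 / q = 2 powr L" unfolding L_def using assms by simp
  also have "\<dots> \<le> 2 powr real r" using r by simp
  also have "\<dots> = 2 ^ r" by (simp add: powr_realpow)
  finally have qr: "1 / 2 ^ r \<le> q" using assms by (simp add: field_simps)
  have "(\<Sum>j<m. tent m j q) \<le> (\<Sum>j<m. min (2 ^ j / 2 ^ m) q)"
    by (intro sum_mono) (simp add: tent_def)
  also have "\<dots> = (\<Sum>i<m. min (2 ^ (m - Suc i) / 2 ^ m) q)"
    by (rule sum.nat_diff_reindex[symmetric])
  also have "\<dots> = (\<Sum>i<m. min (1 / 2 ^ Suc i) q)"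
  proof (intro sum.cong refl)
    fix i assume "i \<in> {..<m}"
    then have "(2::real) ^ m = 2 ^ (m - Suc i) * 2 ^ Suc i" by (simp add: power_add[symmetric] del: power_Suc)
    then show "min (2 ^ (m - Suc i) / 2 ^ m) q = min (1 / 2 ^ Suc i) q" by simp
  qed
  also have "\<dots> \<le> real (min m r) * q + 1 / 2 ^ r - 1 / 2 ^ (max m r)"
    by (rule sum_min_geometric) (use assms in simp)
  also have "\<dots> \<le> real r * q + 1 / 2 ^ r"
  proof -
    have "real (min m r) * q \<le> real r * q" using assms by (intro mult_right_mono) auto
    moreover have "0 \<le> 1 / (2::real) ^ max m r" by simp
    ultimately show ?thesis by linarith
  qed
  also have "\<dots> \<le> (L + 1) * q + q"
    using r qr assms by (intro add_mono mult_right_mono) auto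
  also have "\<dots> \<le> 3 * (q * L)" using L1 assms mult_left_mono[of 1 L q] by (simp add: algebra_simps)
  also have "\<dots> \<le> 3 * Ent q" using Ent_lower[OF assms] by (simp add: L_def)
  finally show ?thesis .
qed

lemma tent_sym: "tent m j (1 - q) = tent m j q"
  by (simp add: tent_def min.commute)

lemma sum_tent_le_Ent:
  assumes "0 \<le> q" "q \<le> 1"
  shows "(\<Sum>j<m. tent m j q) \<le> 3 * Ent q"
proof -
  consider "q = 0 \<or> q = 1" | "0 < q" "q \<le> 1/2" | "0 < 1 - q" "1 - q \<le> 1/2" using assms by linarith
  then show ?thesis
  proof cases
    case 1
    then show ?thesis by (auto simp: tent_def Ent_def)
  next
    case 2
    then show ?thesis by (rule sum_tent_le_Ent_half)
  next
    case 3
    then show ?thesis using sum_tent_le_Ent_half[of "1 - q" m] by (simp add: tent_sym Ent_sym)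
  qed
qed

lemma min_concave:
  fixes u a b v c :: real
  assumes "u \<le> a" "u \<le> b" "a + b = u + v"
  shows "min c (min u (1 - u)) + min c (min v (1 - v)) \<le> min c (min a (1 - a)) + min c (min b (1 - b))"
  using assms by (auto simp: min_def)

lemma nat_concave_sum_tent: "nat_concave (\<lambda>s. \<Sum>j<m. tent m j (real s / M))"
  if "M > 0" for M :: real
  unfolding nat_concave_def
proof (intro allI impI)
  fix u a b v :: nat assume *: "u \<le> a" "u \<le> b" "a + b = u + v"
  have "tent m j (real u / M) + tent m j (real v / M) \<le> tent m j (real a / M) + tent m j (real b / M)" for j
    unfolding tent_def
  proof (rule min_concave)
    show "real u / M \<le> real a / M" "real u / M \<le> real b / M" using * that by (auto intro: divide_right_mono)
    have "real a + real b = real u + real v" using * by linarith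
    then show "real a / M + real b / M = real u / M + real v / M" by (metis add_divide_distrib)
  qed
  then show "(\<Sum>j<m. tent m j (real u / M)) + (\<Sum>j<m. tent m j (real v / M))
      \<le> (\<Sum>j<m. tent m j (real a / M)) + (\<Sum>j<m. tent m j (real b / M))"
    unfolding sum.distrib[symmetric] by (intro sum_mono)
qed

lemma fiber_count_le: "fiber_count M F k x \<le> M"
  unfolding fiber_count_def using card_mono[of "{..<M}" "{a. a < M \<and> x(k := a) \<in> F}"] by auto

text \<open>
  The three ingredients combined: \<open>F\<close> is replaced by an upward closed set \<open>H\<close> without increasing the
  mean of \<open>\<phi> = (\<Sum>j<m. tent m j)\<close> over the fibres, the digits of a coordinate then have total influence
  at most \<open>6 * J\<close>, and \<open>KKL_inequality\<close> applies to the resulting function of \<open>card K * m\<close> bits.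
\<close>

lemma grid_influence_inequality:
  assumes K: "finite K" and F: "F \<subseteq> grid K (2 ^ m)"
    and J: "\<And>k. k \<in> K \<Longrightarrow> (\<Sum>x\<in>grid K (2 ^ m). Ent (fiber_count (2 ^ m) F k x / 2 ^ m)) / real (2 ^ m) ^ card K \<le> J"
  defines "q \<equiv> real (card F) / real (2 ^ m) ^ card K"
  shows "4 * (q * (1 - q)) \<le> real (card K) * (6 * J) * (3 ^ d * sqrt (6 * J) + 1 / real (d + 1))"
proof -
  define \<phi> where "\<phi> s = (\<Sum>j<m. tent m j (real s / 2 ^ m))" for s
  have \<phi>: "nat_concave \<phi>" unfolding \<phi>_def by (rule nat_concave_sum_tent) simp
  obtain H where H: "H \<subseteq> grid K (2 ^ m)" "card H = card F"
    and le: "\<And>k. k \<in> K \<Longrightarrow> grid_influence K (2 ^ m) \<phi> H k \<le> grid_influence K (2 ^ m) \<phi> F k"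
    and up: "\<And>k x b. k \<in> K \<Longrightarrow> x \<in> H \<Longrightarrow> x k < b \<Longrightarrow> b < 2 ^ m \<Longrightarrow> x(k := b) \<in> H"
    using monotone_rearrangement[OF K F \<phi>] by blast
  define V where "V = K \<times> {..<m}"
  define f where "f X = (of_bool (decode K X \<in> H) :: real)" for X
  define I where "I v = bit_influence V f v" for v
  have V: "finite V" using K by (simp add: V_def)
  have I0: "0 \<le> I v" for v unfolding I_def bit_influence_def by (intro cube_avg_nonneg) simp
  have sum_I: "(\<Sum>j<m. I (k, j)) \<le> 6 * J" if k: "k \<in> K" for k
  proof -
    let ?N = "real (2 ^ m) ^ card K"
    have "(\<Sum>j<m. I (k, j)) \<le> (\<Sum>j<m. 2 * (\<Sum>x\<in>grid K (2 ^ m). tent m j (fiber_count (2 ^ m) H k x / 2 ^ m)) / ?N)"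
      unfolding I_def V_def f_def using up[OF k]
      by (intro sum_mono bit_influence_decode[OF K k _ H(1)]) auto
    also have "\<dots> = 2 * (\<Sum>j<m. \<Sum>x\<in>grid K (2 ^ m). tent m j (fiber_count (2 ^ m) H k x / 2 ^ m)) / ?N"
      by (simp only: sum_divide_distrib sum_distrib_left)
    also have "\<dots> = 2 * grid_influence K (2 ^ m) \<phi> H k / ?N"
      unfolding grid_influence_def \<phi>_def by (subst sum.swap) simp
    also have "\<dots> \<le> 2 * grid_influence K (2 ^ m) \<phi> F k / ?N"
      using le[OF k] by (intro divide_right_mono) auto
    also have "\<dots> \<le> 2 * (\<Sum>x\<in>grid K (2 ^ m). 3 * Ent (fiber_count (2 ^ m) F k x / 2 ^ m)) / ?N"
    proof (intro divide_right_mono mult_left_mono)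
      show "grid_influence K (2 ^ m) \<phi> F k \<le> (\<Sum>x\<in>grid K (2 ^ m). 3 * Ent (fiber_count (2 ^ m) F k x / 2 ^ m))"
        unfolding grid_influence_def \<phi>_def
      proof (intro sum_mono sum_tent_le_Ent)
        fix x
        have "real (fiber_count (2 ^ m) F k x) \<le> real (2 ^ m)"
          by (intro of_nat_mono fiber_count_le)
        then show "real (fiber_count (2 ^ m) F k x) / 2 ^ m \<le> 1" by simp
      qed simp
    qed auto
    also have "\<dots> = 6 * ((\<Sum>x\<in>grid K (2 ^ m). Ent (fiber_count (2 ^ m) F k x / 2 ^ m)) / ?N)"
      by (simp add: sum_distrib_left[symmetric])
    also have "\<dots> \<le> 6 * J" using J[OF k] by simp
    finally show ?thesis .
  qed
  have I_le: "I v \<le> 6 * J" if vV: "v \<in> V" for v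
  proof -
    obtain k j where v: "v = (k, j)" "k \<in> K" "j < m" using vV by (cases v) (auto simp: V_def)
    have "I v \<le> (\<Sum>j<m. I (k, j))" unfolding v(1) using v(3) I0 by (intro member_le_sum) auto
    also have "\<dots> \<le> 6 * J" by (rule sum_I) (rule v)
    finally show ?thesis .
  qed
  have "(\<Sum>v\<in>V. I v) = (\<Sum>k\<in>K. \<Sum>j<m. I (k, j))"
    unfolding V_def by (simp add: sum.cartesian_product)
  also have "\<dots> \<le> real (card K) * (6 * J)" by (rule sum_bounded_above) (rule sum_I)
  finally have total: "(\<Sum>v\<in>V. I v) \<le> real (card K) * (6 * J)" .
  have "(\<Sum>X\<in>Pow V. f X) = (\<Sum>x\<in>grid K (2 ^ m). of_bool (x \<in> H) * 1)"
    unfolding V_def f_def mult_1_right by (rule sum.reindex_bij_betw[OF bij_decode])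
  also have "\<dots> = real (card F)" using sum_indicator_grid[OF K H(1), of "\<lambda>_. 1"] H(2) by simp
  finally have avg: "cube_avg V f = q"
    unfolding cube_avg_def q_def V_def by (simp add: power_mult[symmetric] card_cartesian_product)
  show ?thesis
  proof (cases "V = {}")
    case True
    \<comment> \<open>Without bits the grid has one point, so \<open>q\<close> is \<open>0\<close> or \<open>1\<close>.\<close>
    have "K = {} \<or> m = 0" using True unfolding V_def by auto
    then have "real (2 ^ m) ^ card K = 1" by auto
    moreover have "cube_avg V f \<in> {0, 1}" using True by (simp add: cube_avg_def f_def)
    ultimately have q: "q * (1 - q) = 0" using avg by auto
    have "0 \<le> real (card K) * (6 * J)" using total True by simp
    moreover have "0 \<le> 3 ^ d * sqrt (6 * J) + 1 / real (d + 1)" if "K \<noteq> {}"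
    proof -
      from that obtain k where "k \<in> K" by auto
      from sum_I[OF this] have "0 \<le> 6 * J"
        by (rule order_trans[rotated]) (intro sum_nonneg I0)
      then show ?thesis by simp
    qed
    ultimately show ?thesis unfolding q by (cases "K = {}") (auto intro!: mult_nonneg_nonneg)
  next
    case False
    then obtain v where "v \<in> V" by auto
    then have J0: "0 \<le> 6 * J" using I0[of v] I_le[of v] by linarith
    have "4 * (q * (1 - q)) \<le> (\<Sum>v\<in>V. I v) * (3 ^ d * sqrt (6 * J) + 1 / real (d + 1))"
      unfolding avg[symmetric] I_def by (rule KKL_inequality[OF V]) (use I_le in \<open>auto simp: I_def f_def\<close>)
    also have "\<dots> \<le> real (card K) * (6 * J) * (3 ^ d * sqrt (6 * J) + 1 / real (d + 1))"
      using J0 by (intro mult_right_mono total) auto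
    finally show ?thesis .
  qed
qed

text \<open>
  If \<open>J\<close> were smaller, then \<open>6 * J\<close> would be below \<open>1 / sqrt n\<close>. With \<open>L = log 2 n\<close> and
  \<open>d = \<lfloor>L / 16\<rfloor>\<close>, the factor \<open>3 ^ d \<le> 2 powr (L / 8)\<close> is beaten by \<open>sqrt (6 * J) \<le> 2 powr (- L / 4)\<close>,
  so both terms of the inequality are \<open>O(1 / L)\<close>. They give \<open>4 * v \<le> 144 * n * J / L\<close>, a contradiction.
\<close>

lemma log_bound_of_KKL:
  fixes v J :: real
  assumes n: "2 \<le> n" and v: "v \<le> 1/4"  and J: "0 \<le> J"
    and KKL: "\<And>d. 4 * v \<le> real n * (6 * J) * (3 ^ d * sqrt (6 * J) + 1 / real (d + 1))"
  shows "1/36 * v * (log 2 (real n) / real n) \<le> J"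
proof (rule ccontr)
  assume "\<not> ?thesis"
  then have less: "J < 1/36 * v * (log 2 (real n) / real n)" by simp
  define L where "L = log 2 (real n)"
  have L1: "1 \<le> L" unfolding L_def using n by simp
  have n0: "0 < real n" using n by simp
  have v0: "0 < v"
  proof (rule ccontr)
    assume "\<not> 0 < v"
    then have "1/36 * v * (log 2 (real n) / real n) \<le> 0"
      using mult_nonpos_nonneg[of "1/36 * v" "log 2 (real n) / real n"] L1 n0 unfolding L_def by simp
    then show False using less J by linarith
  qed
  have nL: "real n = 2 powr L" unfolding L_def using n0 by simp
  have powr_ge: "y \<le> 2 powr y" for y :: real
  proof (cases "y \<le> 0")
    case True
    then show ?thesis using powr_ge_zero[of 2 y] by linarith
  next
    case False
    define k where "k = nat \<lfloor>y\<rfloor>"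
    have k: "real k \<le> y" "y < real k + 1" unfolding k_def using False by linarith+
    have "k < 2 ^ k" by (rule less_exp)
    then have "real k + 1 \<le> 2 ^ k" by (metis Suc_leI of_nat_Suc of_nat_mono of_nat_numeral of_nat_power add.commute)
    also have "\<dots> = 2 powr real k" by (simp add: powr_realpow)
    also have "\<dots> \<le> 2 powr y" using k by simp
    finally show ?thesis using k by linarith
  qed
  have "6 * J \<le> 1/24 * (L / real n)"
  proof -
    have "1/36 * v * (L / real n) \<le> 1/36 * (1/4) * (L / real n)"
      using v L1 n0 by (intro mult_right_mono) auto
    then show ?thesis using less unfolding L_def[symmetric] by linarith
  qed
  also have "\<dots> \<le> 2 powr (L/2) / real n"
  proof -
    have "1/24 * L \<le> 2 powr (L/2)" using powr_ge[of "L/2"] powr_ge_zero[of 2 "L/2"] by linarith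
    from divide_right_mono[OF this, of "real n"] show ?thesis by simp
  qed
  also have "\<dots> = 2 powr (- (L/2))" unfolding nL by (simp add: powr_diff[symmetric])
  finally have J1: "6 * J \<le> 2 powr (- (L/2))" .
  have sq: "sqrt (6 * J) \<le> 2 powr (- (L/4))"
  proof (rule real_le_lsqrt)
    show "6 * J \<le> (2 powr (- (L/4)))\<^sup>2" using J1 by (simp add: power2_eq_square powr_add[symmetric])
  qed simp
  define d where "d = nat \<lfloor>L/16\<rfloor>"
  have d: "real d \<le> L/16" "L/16 < real d + 1" unfolding d_def using L1 by linarith+
  have "(3::real) ^ d \<le> 4 ^ d" by (intro power_mono) auto
  also have "\<dots> = 2 powr (2 * real d)" by (simp add: powr_realpow[symmetric] powr_powr[symmetric])
  also have "\<dots> \<le> 2 powr (L/8)" using d by simp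
  finally have "3 ^ d * sqrt (6 * J) \<le> 2 powr (L/8) * 2 powr (- (L/4))"
    using sq J by (intro mult_mono) auto
  also have "\<dots> = 1 / 2 powr (L/8)" by (simp add: powr_add[symmetric] powr_minus_divide[symmetric])
  also have "\<dots> \<le> 8 / L"
    using powr_ge[of "L/8"] L1 by (simp add: field_simps)
  finally have t1: "3 ^ d * sqrt (6 * J) \<le> 8 / L" .
  have t2: "1 / real (d + 1) \<le> 16 / L" using d L1 by (simp add: field_simps)
  have "4 * v \<le> real n * (6 * J) * (3 ^ d * sqrt (6 * J) + 1 / real (d + 1))" by (rule KKL)
  also have "\<dots> \<le> real n * (6 * J) * (8 / L + 16 / L)"
    using t1 t2 J by (intro mult_left_mono) auto
  also have "\<dots> = 144 * (real n * J / L)" by simp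
  also have "\<dots> < 144 * (1/36 * v)"
    using less L1 n0 unfolding L_def[symmetric] by (simp add: field_simps)
  finally show False by simp
qed

section \<open>Dyadic approximation in the unit cube\<close>

lemma space_unit_interval [simp]: "space unit_interval = {0..1}"
  by (simp add: unit_interval_def space_restrict_space)

interpretation unit_interval: prob_space unit_interval
  by (rule prob_spaceI) (simp add: unit_interval_def emeasure_restrict_space space_restrict_space)

lemma measure_unit_interval [simp]: "measure unit_interval {0..1} = 1"
  using unit_interval.prob_space by simp

interpretation cube: product_prob_space "\<lambda>_::nat. unit_interval" "{1..n}" for n :: nat
  by standard

lemma space_cube: "space (cube n) = (\<Pi>\<^sub>E k\<in>{1..n}. {0..1})"
  by (simp add: cube_def space_PiM)

lemma measure_cube_box:
  assumes "\<And>k. k \<in> {1..n} \<Longrightarrow> X k \<in> sets unit_interval"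
  shows "measure (cube n) (\<Pi>\<^sub>E k\<in>{1..n}. X k) = (\<Prod>k\<in>{1..n}. measure unit_interval (X k))"
proof -
  interpret finite_product_prob_space "\<lambda>_::nat. unit_interval" "{1..n}" by standard simp
  show ?thesis unfolding cube_def using assms by (rule prob_times)
qed

lemma prob_space_cube: "prob_space (cube n)"
proof -
  interpret finite_product_prob_space "\<lambda>_::nat. unit_interval" "{1..n}" by standard simp
  show ?thesis unfolding cube_def by (rule prob_space_axioms)
qed

interpretation cube_prob: prob_space "cube n" for n
  by (rule prob_space_cube)

lemma cube_upd: "x \<in> space (cube n) \<Longrightarrow> k \<in> {1..n} \<Longrightarrow> t \<in> {0..1} \<Longrightarrow> x(k := t) \<in> space (cube n)"
  by (auto simp: space_cube PiE_iff extensional_def)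

lemma measurable_cube_upd:
  assumes k: "k \<in> {1..n}"
  shows "(\<lambda>(x, t). x(k := t)) \<in> cube n \<Otimes>\<^sub>M unit_interval \<rightarrow>\<^sub>M cube n"
proof -
  have "insert k {1..n} = {1..n}" using k by auto
  then show ?thesis
    using measurable_add_dim[of k "{1..n}" "\<lambda>_. unit_interval"] unfolding cube_def by simp
qed

lemma measurable_fiber_integral:
  fixes F :: "(nat \<Rightarrow> real) \<Rightarrow> real"
  assumes k: "k \<in> {1..n}" and F: "F \<in> borel_measurable (cube n)"
  shows "(\<lambda>x. LINT t|unit_interval. F (x(k := t))) \<in> borel_measurable (cube n)"
proof (rule unit_interval.borel_measurable_lebesgue_integral)
  show "(\<lambda>(x, t). F (x(k := t))) \<in> borel_measurable (cube n \<Otimes>\<^sub>M unit_interval)"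
    using measurable_compose[OF measurable_cube_upd[OF k] F] by (simp add: case_prod_unfold)
qed

lemma measurable_fiber:
  assumes k: "k \<in> {1..n}" and F: "F \<in> borel_measurable (cube n)" and x: "x \<in> space (cube n)"
  shows "(\<lambda>t. F (x(k := t))) \<in> borel_measurable unit_interval"
  using measurable_compose[OF measurable_Pair1'[OF x] measurable_compose[OF measurable_cube_upd[OF k] F]]
  by simp

lemma (in prob_space) integral_in_Icc:
  fixes F :: "'a \<Rightarrow> real"
  assumes "F \<in> borel_measurable M" "\<And>x. x \<in> space M \<Longrightarrow> F x \<in> {a..b}"
  shows "integrable M F" "integral\<^sup>L M F \<in> {a..b}"
proof -
  show int: "integrable M F"
  proof (rule integrable_const_bound[where B = "max \<bar>a\<bar> \<bar>b\<bar>"])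
    show "AE x in M. norm (F x) \<le> max \<bar>a\<bar> \<bar>b\<bar>" using assms(2) by (intro AE_I2) (fastforce simp: abs_le_iff)
  qed (rule assms)
  have "integral\<^sup>L M (\<lambda>_. a) \<le> integral\<^sup>L M F"
    by (rule integral_mono) (use int assms(2) in auto)
  moreover have "integral\<^sup>L M F \<le> integral\<^sup>L M (\<lambda>_. b)"
    by (rule integral_mono) (use int assms(2) in auto)
  ultimately
  show "integral\<^sup>L M F \<in> {a..b}" by (simp add: prob_space)
qed

text \<open>
  Drawing the coordinate \<open>k\<close> once more does not change the distribution of \<open>x\<close>. This carries closeness
  in mean over to the fibre means.
\<close>

lemma cube_integral_resample:
  fixes F :: "(nat \<Rightarrow> real) \<Rightarrow> real"
  assumes k: "k \<in> {1..n}" and F: "F \<in> borel_measurable (cube n)"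
    and bd: "\<And>x. x \<in> space (cube n) \<Longrightarrow> F x \<in> {0..1}"
  shows "(LINT x|cube n. LINT t|unit_interval. F (x(k := t))) = (LINT x|cube n. F x)"
proof -
  let ?g = "\<lambda>x. LINT t|unit_interval. F (x(k := t))"
  let ?R = "PiM ({1..n} - {k}) (\<lambda>_. unit_interval)"
  have ins: "insert k ({1..n} - {k}) = {1..n}" using k by auto
  have g01: "?g x \<in> {0..1}" if "x \<in> space (cube n)" for x
    using unit_interval.integral_in_Icc(2)[OF measurable_fiber[OF k F that], of 0 1]
      bd cube_upd[OF that k] by simp
  have "integrable (cube n) F" "integrable (cube n) ?g"
    using cube_prob.integral_in_Icc(1)[OF F bd]
      cube_prob.integral_in_Icc(1)[OF measurable_fiber_integral[OF k F] g01] by auto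
  moreover have "integral\<^sup>L (cube n) f = (LINT x|?R. LINT s|unit_interval. f (x(k := s)))"
    if "integrable (cube n) f" for f :: "(nat \<Rightarrow> real) \<Rightarrow> real"
    using cube.product_integral_insert[of "{1..n} - {k}" k f] that unfolding cube_def ins by blast
  ultimately have "(LINT x|cube n. F x) = (LINT x|?R. ?g x)"
    "(LINT x|cube n. ?g x) = (LINT x|?R. LINT s|unit_interval. ?g (x(k := s)))"
    by blast+
  then show ?thesis by simp
qed

text \<open>
  The minimum assigns the right endpoint \<open>t = 1\<close> to the last dyadic interval.
\<close>

definition dyadic_index :: "nat \<Rightarrow> real \<Rightarrow> nat" where
  "dyadic_index m t = min (nat \<lfloor>2 ^ m * t\<rfloor>) (2 ^ m - 1)"

definition cell :: "nat \<Rightarrow> nat \<Rightarrow> (nat \<Rightarrow> real) \<Rightarrow> nat \<Rightarrow> nat" where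
  "cell n m x = (\<lambda>k\<in>{1..n}. dyadic_index m (x k))"

lemma dyadic_index_less: "dyadic_index m t < 2 ^ m"
  by (simp add: dyadic_index_def min_less_iff_disj)

lemma cell_in_grid: "cell n m x \<in> grid {1..n} (2 ^ m)"
  by (auto simp: cell_def dyadic_index_less)

lemma cell_upd: "k \<in> {1..n} \<Longrightarrow> cell n m (x(k := t)) = (cell n m x)(k := dyadic_index m t)"
  by (auto simp: cell_def)

lemma dyadic_interval:
  assumes "a < 2 ^ m"
  shows "{t \<in> {0..1}. dyadic_index m t = a} \<in> sets unit_interval"
    and "measure unit_interval {t \<in> {0..1}. dyadic_index m t = a} = 1 / 2 ^ m"
proof -
  define M where "M = (2::real) ^ m"
  have M: "M > 0" "real (2 ^ m) = M" by (simp_all add: M_def)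
  define I where "I = (if Suc a < 2 ^ m then {real a / M..<(real a + 1) / M} else {real a / M..1})"
  have top: "real a + 1 = M" if "\<not> Suc a < 2 ^ m"
  proof -
    have "Suc a = 2 ^ m" using that assms by linarith
    then have "real (Suc a) = real (2 ^ m)" by (rule arg_cong)
    then show ?thesis by (simp add: M_def)
  qed
  have aM: "real a + 1 \<le> M"
  proof -
    have "real (Suc a) \<le> real (2 ^ m)" using assms by (intro of_nat_mono) simp
    then show ?thesis by (simp add: M_def)
  qed
  have fl: "nat \<lfloor>M * t\<rfloor> = b \<longleftrightarrow> real b \<le> M * t \<and> M * t < real b + 1" if "0 \<le> t" for t b
  proof -
    have "0 \<le> M * t" using that M by simp
    then show ?thesis by linarith
  qed
  have eq: "{t \<in> {0..1}. dyadic_index m t = a} = I"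
  proof (cases "Suc a < 2 ^ m")
    case True
    then have "{t \<in> {0..1}. dyadic_index m t = a} = {t \<in> {0..1}. nat \<lfloor>M * t\<rfloor> = a}"
      by (auto simp: dyadic_index_def M_def min_def)
    also have "\<dots> = {t \<in> {0..1}. real a \<le> M * t \<and> M * t < real a + 1}"
      using fl by auto
    also have "\<dots> = I"
    proof -
      have "t \<le> 1" if "M * t < real a + 1" for t
      proof -
        have "M * t < M * 1" using that aM by linarith
        then show ?thesis using M by (simp add: mult_less_cancel_left_pos)
      qed
      moreover have "0 \<le> t" if "real a \<le> M * t" for t
        using that M by (metis of_nat_0_le_iff order_trans zero_le_mult_iff not_less)
      ultimately show ?thesis using True M by (auto simp: I_def field_simps)
    qed
    finally show ?thesis .
  next
    case False
    then have "a = 2 ^ m - 1" using assms by linarith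
    then have "{t \<in> {0..1}. dyadic_index m t = a} = {t \<in> {0..1}. a \<le> nat \<lfloor>M * t\<rfloor>}"
      by (auto simp: dyadic_index_def M_def)
    also have "\<dots> = {t \<in> {0..1}. real a \<le> M * t}"
    proof -
      have "a \<le> nat \<lfloor>M * t\<rfloor> \<longleftrightarrow> real a \<le> M * t" if "0 \<le> t" for t
        using that M by (simp add: le_nat_iff le_floor_iff)
      then show ?thesis by auto
    qed
    also have "\<dots> = I"
    proof -
      have "0 \<le> t" if "real a \<le> M * t" for t
        using that M by (metis of_nat_0_le_iff order_trans zero_le_mult_iff not_less)
      then show ?thesis using False M by (auto simp: I_def field_simps)
    qed
    finally show ?thesis .
  qed
  have sub: "I \<subseteq> {0..1}" unfolding eq[symmetric] by auto
  have meas: "I \<in> sets borel" unfolding I_def by auto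
  show "{t \<in> {0..1}. dyadic_index m t = a} \<in> sets unit_interval"
    unfolding eq using sub meas by (auto simp: unit_interval_def sets_restrict_space)
  have "measure unit_interval I = measure lborel I"
    unfolding unit_interval_def using sub by (subst measure_restrict_space) auto
  also have "\<dots> = 1 / M"
  proof (cases "Suc a < 2 ^ m")
    case True
    have "real a / M \<le> (real a + 1) / M" using M(1) by (intro divide_right_mono) auto
    then show ?thesis using True by (simp add: I_def diff_divide_distrib[symmetric])
  next
    case False
    have "1 - real a / M = 1 / M" using top[OF False] M(1) by (simp add: field_simps)
    moreover have "real a / M \<le> 1" using aM M(1) by simp
    ultimately show ?thesis using False by (simp add: I_def)
  qed
  finally show "measure unit_interval {t \<in> {0..1}. dyadic_index m t = a} = 1 / 2 ^ m"
    unfolding eq M_def .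
qed

lemma cell_preimage:
  assumes i: "i \<in> grid {1..n} (2 ^ m)"
  shows "{x \<in> space (cube n). cell n m x = i} \<in> sets (cube n)"
    and "measure (cube n) {x \<in> space (cube n). cell n m x = i} = 1 / real (2 ^ m) ^ n"
proof -
  have eq: "{x \<in> space (cube n). cell n m x = i} = (\<Pi>\<^sub>E k\<in>{1..n}. {t \<in> {0..1}. dyadic_index m t = i k})"
    using i by (auto simp: space_cube cell_def PiE_iff fun_eq_iff extensional_def)
  have I: "i k < 2 ^ m" if "k \<in> {1..n}" for k using i that by (auto simp: PiE_iff)
  show "{x \<in> space (cube n). cell n m x = i} \<in> sets (cube n)"
    unfolding eq unfolding cube_def by (intro sets_PiM_I_finite dyadic_interval I) auto
  have "measure (cube n) {x \<in> space (cube n). cell n m x = i}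
      = (\<Prod>k\<in>{1..n}. measure unit_interval {t \<in> {0..1}. dyadic_index m t = i k})"
    unfolding eq by (rule measure_cube_box) (intro dyadic_interval(1) I)
  also have "\<dots> = (\<Prod>k\<in>{1..n}. 1 / 2 ^ m)"
    by (intro prod.cong refl dyadic_interval(2) I)
  finally show "measure (cube n) {x \<in> space (cube n). cell n m x = i} = 1 / real (2 ^ m) ^ n"
    by (simp add: power_divide)
qed

lemma (in finite_measure) integral_finite_partition:
  fixes u :: "'b \<Rightarrow> real"
  assumes I: "finite I" "\<And>x. x \<in> space M \<Longrightarrow> g x \<in> I"
    and g: "\<And>i. i \<in> I \<Longrightarrow> {x \<in> space M. g x = i} \<in> sets M"
    and w: "\<And>i. i \<in> I \<Longrightarrow> measure M {x \<in> space M. g x = i} = w"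
  shows "(LINT x|M. u (g x)) = (\<Sum>i\<in>I. u i) * w"
proof -
  have "(LINT x|M. u (g x)) = (LINT x|M. (\<Sum>i\<in>I. u i * indicator {x \<in> space M. g x = i} x))"
  proof (rule Bochner_Integration.integral_cong[OF refl])
    fix x assume x: "x \<in> space M"
    have "(\<Sum>i\<in>I. u i * indicator {x \<in> space M. g x = i} x) = (\<Sum>i\<in>I. if i = g x then u (g x) else 0)"
      by (intro sum.cong refl) (use x in \<open>auto simp: indicator_def\<close>)
    then show "u (g x) = (\<Sum>i\<in>I. u i * indicator {x \<in> space M. g x = i} x)"
      using I x by simp
  qed
  also have "\<dots> = (\<Sum>i\<in>I. u i * w)"
    using g w by (subst Bochner_Integration.integral_sum) (auto simp: less_top[symmetric])
  finally show ?thesis by (simp add: sum_distrib_right)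
qed

lemma finite_grid: "finite (grid {1..n::nat} M)"
  by (intro finite_PiE) auto

lemma integral_cell:
  fixes u :: "(nat \<Rightarrow> nat) \<Rightarrow> real"
  shows "(LINT x|cube n. u (cell n m x)) = (\<Sum>i\<in>grid {1..n} (2 ^ m). u i) / real (2 ^ m) ^ n"
proof -
  have "(LINT x|cube n. u (cell n m x)) = (\<Sum>i\<in>grid {1..n} (2 ^ m). u i) * (1 / real (2 ^ m) ^ n)"
    by (intro cube_prob.integral_finite_partition finite_grid cell_in_grid cell_preimage)
  then show ?thesis by simp
qed

lemma integral_dyadic_index:
  fixes u :: "nat \<Rightarrow> real"
  shows "(LINT t|unit_interval. u (dyadic_index m t)) = (\<Sum>a<2 ^ m. u a) / 2 ^ m"
proof -
  have "(LINT t|unit_interval. u (dyadic_index m t)) = (\<Sum>a<2 ^ m. u a) * (1 / 2 ^ m)"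
    by (rule unit_interval.integral_finite_partition)
       (simp_all add: dyadic_index_less dyadic_interval[simplified])
  then show ?thesis by simp
qed

lemma mult_minus_one_div:
  fixes D E :: nat
  assumes "1 \<le> D" "1 \<le> E"
  shows "(E * D - 1) div D = E - 1"
proof -
  have "E * D - 1 = (D - 1) + (E - 1) * D" using assms by (cases E) auto
  also have "\<dots> div D = (E - 1) + (D - 1) div D" by (rule div_mult_self1) (use assms in simp)
  finally show ?thesis using assms by simp
qed

text \<open>
  Refining the partition \<open>d\<close> times appends \<open>d\<close> binary digits to the index.
\<close>

lemma dyadic_index_refine:
  assumes t: "t \<in> {0..1}"
  shows "dyadic_index m t = dyadic_index (m + d) t div 2 ^ d"
proof -
  have "\<lfloor>2 ^ m * t\<rfloor> = \<lfloor>2 ^ (m + d) * t / real_of_int (2 ^ d)\<rfloor>" by (simp add: power_add)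
  also have "\<dots> = \<lfloor>2 ^ (m + d) * t\<rfloor> div 2 ^ d" by (rule floor_divide_real_eq_div) simp
  finally have "nat \<lfloor>2 ^ m * t\<rfloor> = nat \<lfloor>2 ^ (m + d) * t\<rfloor> div 2 ^ d"
    using t by (simp add: nat_div_distrib nat_power_eq)
  moreover have "(2::nat) ^ m - 1 = (2 ^ (m + d) - 1) div 2 ^ d"
    using mult_minus_one_div[of "2 ^ d" "2 ^ m"] by (simp add: power_add)
  moreover have "min a b div 2 ^ d = min (a div 2 ^ d) (b div 2 ^ d)" for a b :: nat
    by (cases a b rule: linorder_le_cases) (auto simp: min_absorb1 min_absorb2 div_le_mono)
  ultimately show ?thesis by (simp add: dyadic_index_def)
qed

definition cell_union :: "nat \<Rightarrow> nat \<Rightarrow> (nat \<Rightarrow> nat) set \<Rightarrow> (nat \<Rightarrow> real) set" where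
  "cell_union n m F = {x \<in> space (cube n). cell n m x \<in> F}"

lemma sets_cell_union: "cell_union n m F \<in> sets (cube n)"
proof -
  have "cell_union n m F = (\<Union>i\<in>F \<inter> grid {1..n} (2 ^ m). {x \<in> space (cube n). cell n m x = i})"
    using cell_in_grid[of n m] by (auto simp: cell_union_def)
  also have "\<dots> \<in> sets (cube n)"
    using finite_grid cell_preimage(1) by (intro sets.finite_UN) auto
  finally show ?thesis .
qed

lemma cell_union_refine: "\<exists>F'. cell_union n m F = cell_union n (m + d) F'"
proof -
  have "cell n m x = (\<lambda>k\<in>{1..n}. cell n (m + d) x k div 2 ^ d)" if "x \<in> space (cube n)" for x
    using that by (auto simp: cell_def space_cube PiE_iff fun_eq_iff dyadic_index_refine[of _ m d])
  then have "cell_union n m F = cell_union n (m + d) {i. (\<lambda>k\<in>{1..n}. i k div 2 ^ d) \<in> F}"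
    by (auto simp: cell_union_def)
  then show ?thesis by blast
qed

lemma cell_union_Un: "\<exists>m F. cell_union n m1 F1 \<union> cell_union n m2 F2 = cell_union n m F"
proof -
  obtain G1 where G1: "cell_union n m1 F1 = cell_union n (m1 + m2) G1" using cell_union_refine by blast
  obtain G2 where G2: "cell_union n m2 F2 = cell_union n (m2 + m1) G2" using cell_union_refine by blast
  have "cell_union n m1 F1 \<union> cell_union n m2 F2 = cell_union n (m1 + m2) (G1 \<union> G2)"
    unfolding G1 G2 by (auto simp: cell_union_def add.commute)
  then show ?thesis by blast
qed

lemma cell_union_UN:
  fixes N :: nat
  assumes "\<And>i. i < N \<Longrightarrow> \<exists>m F. B i = cell_union n m F"
  shows "\<exists>m F. (\<Union>i<N. B i) = cell_union n m F"
  using assms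
proof (induction N)
  case 0
  have "(\<Union>i<0. B i) = cell_union n 0 {}" by (simp add: cell_union_def)
  then show ?case by blast
next
  case (Suc N)
  then obtain m F m' F' where "(\<Union>i<N. B i) = cell_union n m F" "B N = cell_union n m' F'"
    by (meson lessI less_SucI)
  then show ?case using cell_union_Un[of n m F m' F'] by (simp add: lessThan_Suc Un_commute)
qed

text \<open>
  The Borel sets that dyadic cells approximate in measure. They turn out to form a \<open>\<sigma>\<close>-algebra, and
  therefore to be all Borel sets.
\<close>

definition approximable :: "nat \<Rightarrow> (nat \<Rightarrow> real) set \<Rightarrow> bool" where
  "approximable n A \<longleftrightarrow> A \<in> sets (cube n) \<and>
     (\<forall>e>0. \<exists>m F. measure (cube n) (sym_diff A (cell_union n m F)) < e)"

lemma approximable_Compl: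
  assumes "approximable n A"
  shows "approximable n (space (cube n) - A)"
  unfolding approximable_def
proof (intro conjI allI impI)
  have A: "A \<in> sets (cube n)" "A \<subseteq> space (cube n)"
    using assms sets.sets_into_space by (auto simp: approximable_def)
  then show "space (cube n) - A \<in> sets (cube n)" by auto
  fix e :: real assume "e > 0"
  then obtain m F where mF: "measure (cube n) (sym_diff A (cell_union n m F)) < e"
    using assms by (auto simp: approximable_def)
  have "sym_diff (space (cube n) - A) (cell_union n m (- F)) = sym_diff A (cell_union n m F)"
    using A(2) by (auto simp: cell_union_def)
  then show "\<exists>m F. measure (cube n) (sym_diff (space (cube n) - A) (cell_union n m F)) < e"
    using mF by metis
qed

text \<open>
  A finite part \<open>P N\<close> of the union exhausts it up to \<open>e / 2\<close>, and each of its \<open>N\<close> members is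
  approximated up to \<open>e / (2 * (N + 1))\<close>.
\<close>

lemma approximable_UN:
  fixes A :: "nat \<Rightarrow> (nat \<Rightarrow> real) set"
  assumes A: "\<And>i. approximable n (A i)"
  shows "approximable n (\<Union>i. A i)"
  unfolding approximable_def
proof (intro conjI allI impI)
  have sA: "A i \<in> sets (cube n)" for i using A by (simp add: approximable_def)
  then show sU: "(\<Union>i. A i) \<in> sets (cube n)" by auto
  fix e :: real assume e: "e > 0"
  define P where "P N = (\<Union>i<N. A i)" for N :: nat
  have sP: "P N \<in> sets (cube n)" for N unfolding P_def using sA by auto
  have "incseq P" unfolding P_def by (intro monoI UN_mono) auto
  then have "(\<lambda>N. measure (cube n) (P N)) \<longlonglongrightarrow> measure (cube n) (\<Union>N. P N)"
    using sP by (intro cube_prob.finite_Lim_measure_incseq) auto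
  moreover have UP: "(\<Union>N. P N) = (\<Union>i. A i)" unfolding P_def by auto
  ultimately have "\<forall>\<^sub>F N in sequentially. \<bar>measure (cube n) (P N) - measure (cube n) (\<Union>i. A i)\<bar> < e / 2"
    using e by (auto simp: tendsto_iff dist_real_def dest!: spec[of _ "e / 2"])
  then obtain N where N: "\<bar>measure (cube n) (P N) - measure (cube n) (\<Union>i. A i)\<bar> < e / 2"
    by (auto simp: eventually_sequentially)
  have PU: "P N \<subseteq> (\<Union>i. A i)" unfolding P_def by auto
  then have N': "measure (cube n) ((\<Union>i. A i) - P N) < e / 2"
    using N sP[of N] sU cube_prob.finite_measure_mono[OF PU sU]
    by (simp add: cube_prob.finite_measure_Diff)
  define e' where "e' = e / (2 * (real N + 1))"
  have e': "e' > 0" "real N * e' < e / 2" using e by (simp_all add: e'_def field_simps)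
  have "\<exists>B. (\<exists>m F. B = cell_union n m F) \<and> measure (cube n) (sym_diff (A i) B) < e'" for i
    using A[of i] e'(1) unfolding approximable_def by blast
  then obtain B where B: "\<And>i. \<exists>m F. B i = cell_union n m F" "\<And>i. measure (cube n) (sym_diff (A i) (B i)) < e'"
    by metis
  have sB: "B i \<in> sets (cube n)" for i using B(1)[of i] sets_cell_union by auto
  obtain m F where mF: "(\<Union>i<N. B i) = cell_union n m F" using cell_union_UN[of N B n] B(1) by blast
  have "sym_diff (\<Union>i. A i) (cell_union n m F) \<subseteq> ((\<Union>i. A i) - P N) \<union> (\<Union>i<N. sym_diff (A i) (B i))"
    unfolding mF[symmetric] P_def by blast
  then have "measure (cube n) (sym_diff (\<Union>i. A i) (cell_union n m F))
      \<le> measure (cube n) (((\<Union>i. A i) - P N) \<union> (\<Union>i<N. sym_diff (A i) (B i)))"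
    using sA sB sP sU by (intro cube_prob.finite_measure_mono) auto
  also have "\<dots> \<le> measure (cube n) ((\<Union>i. A i) - P N) + measure (cube n) (\<Union>i<N. sym_diff (A i) (B i))"
    using sA sB sP sU by (intro measure_Un_le) auto
  also have "measure (cube n) (\<Union>i<N. sym_diff (A i) (B i)) \<le> (\<Sum>i<N. measure (cube n) (sym_diff (A i) (B i)))"
    using sA sB by (intro measure_UNION_le) auto
  also have "\<dots> \<le> (\<Sum>i<N. e')" using B(2) by (intro sum_mono less_imp_le)
  also have "\<dots> < e / 2" using e' by simp
  finally show "\<exists>m F. measure (cube n) (sym_diff (\<Union>i. A i) (cell_union n m F)) < e"
    using N' by (intro exI[of _ m] exI[of _ F]) linarith
qed

lemma coordinate_sublevel_sets: "k \<in> {1..n} \<Longrightarrow> {x \<in> space (cube n). x k \<le> a} \<in> sets (cube n)"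
proof -
  assume "k \<in> {1..n}"
  then have "(\<lambda>x. x k) \<in> cube n \<rightarrow>\<^sub>M unit_interval"
    unfolding cube_def by (rule measurable_component_singleton)
  then have "(\<lambda>x. x k) \<in> borel_measurable (cube n)"
    unfolding unit_interval_def by (simp add: measurable_restrict_space2_iff)
  then show ?thesis by measurable
qed

lemma measure_coordinate_index:
  assumes k: "k \<in> {1..n}"
  shows "{x \<in> space (cube n). dyadic_index m (x k) = b} \<in> sets (cube n)"
    and "measure (cube n) {x \<in> space (cube n). dyadic_index m (x k) = b} \<le> 1 / 2 ^ m"
proof -
  let ?S = "{t \<in> {0..1}. dyadic_index m t = b}"
  have S: "?S \<in> sets unit_interval \<and> measure unit_interval ?S \<le> 1 / 2 ^ m"
  proof (cases "b < 2 ^ m")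
    case False
    then have E: "?S = {}" using dyadic_index_less[of m] by auto
    show ?thesis unfolding E by simp
  qed (simp add: dyadic_interval[simplified])
  have eq: "{x \<in> space (cube n). dyadic_index m (x k) = b} = (\<Pi>\<^sub>E j\<in>{1..n}. if j = k then ?S else {0..1})"
  proof -
    have "(\<forall>j\<in>{1..n}. x j \<in> (if j = k then ?S else {0..1}))
        \<longleftrightarrow> (\<forall>j\<in>{1..n}. x j \<in> {0..1}) \<and> dyadic_index m (x k) = b" for x
    proof
      assume *: "\<forall>j\<in>{1..n}. x j \<in> (if j = k then ?S else {0..1})"
      have "x j \<in> {0..1}" if "j \<in> {1..n}" for j
        using *[rule_format, OF that] by (cases "j = k") simp_all
      moreover have "dyadic_index m (x k) = b" using *[rule_format, OF k] by simp
      ultimately show "(\<forall>j\<in>{1..n}. x j \<in> {0..1}) \<and> dyadic_index m (x k) = b" by blast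
    qed simp
    then show ?thesis unfolding space_cube by (intro set_eqI) (simp only: PiE_iff mem_Collect_eq; blast)
  qed
  have meas: "(if j = k then ?S else {0..1}) \<in> sets unit_interval" for j
    using S sets.top[of unit_interval] by simp
  show "{x \<in> space (cube n). dyadic_index m (x k) = b} \<in> sets (cube n)"
    unfolding eq unfolding cube_def using meas by (intro sets_PiM_I_finite) auto
  have "measure (cube n) {x \<in> space (cube n). dyadic_index m (x k) = b}
      = (\<Prod>j\<in>{1..n}. measure unit_interval (if j = k then ?S else {0..1}))"
    unfolding eq by (rule measure_cube_box) (rule meas)
  also have "\<dots> = (\<Prod>j\<in>{1..n}. if j = k then measure unit_interval ?S else 1)"
    using unit_interval.prob_space by (intro prod.cong) auto
  also have "\<dots> = measure unit_interval ?S" using k by simp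
  finally show "measure (cube n) {x \<in> space (cube n). dyadic_index m (x k) = b} \<le> 1 / 2 ^ m"
    using S by simp
qed

text \<open>
  At level \<open>m\<close> the half space is approximated by the cells that lie in it. An error can occur only in
  the slab of cells that contains the boundary and, because of the closed right endpoint, in the last
  slab.
\<close>

lemma approximable_coordinate:
  assumes k: "k \<in> {1..n}"
  shows "approximable n {x \<in> space (cube n). x k \<le> a}"
  unfolding approximable_def
proof (intro conjI allI impI)
  show S: "{x \<in> space (cube n). x k \<le> a} \<in> sets (cube n)" by (rule coordinate_sublevel_sets[OF k])
  fix e :: real assume "e > 0"
  then obtain m where "(1 / 2) ^ m < e / 2"
    using real_arch_pow_inv[of "e / 2" "1 / 2"] by auto
  then have m: "1 / 2 ^ m + 1 / 2 ^ m < e" by (simp add: power_divide)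
  define b where "b = nat \<lfloor>2 ^ m * a\<rfloor>"
  define F where "F = {i :: nat \<Rightarrow> nat. real (i k) + 1 \<le> 2 ^ m * a}"
  have sub: "sym_diff {x \<in> space (cube n). x k \<le> a} (cell_union n m F)
      \<subseteq> {x \<in> space (cube n). dyadic_index m (x k) = b} \<union> {x \<in> space (cube n). dyadic_index m (x k) = 2 ^ m - 1}"
  proof
    fix x assume x: "x \<in> sym_diff {x \<in> space (cube n). x k \<le> a} (cell_union n m F)"
    then have xs: "x \<in> space (cube n)" by (auto simp: cell_union_def)
    then have xk: "0 \<le> x k" "x k \<le> 1" using k by (auto simp: space_cube)
    define i where "i = dyadic_index m (x k)"
    have cell: "x \<in> cell_union n m F \<longleftrightarrow> real i + 1 \<le> 2 ^ m * a"
      using xs k by (simp add: cell_union_def F_def cell_def i_def)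
    have i0: "i = nat \<lfloor>2 ^ m * x k\<rfloor> \<or> i = 2 ^ m - 1" unfolding i_def dyadic_index_def by linarith
    have "i = b" if i: "i = nat \<lfloor>2 ^ m * x k\<rfloor>"
    proof -
      have p: "0 \<le> 2 ^ m * x k" using xk by simp
      then have fl: "real i \<le> 2 ^ m * x k" "2 ^ m * x k < real i + 1" unfolding i by linarith+
      have "x k \<le> a" if "real i + 1 \<le> 2 ^ m * a"
      proof -
        have "2 ^ m * x k \<le> 2 ^ m * a" using fl that by linarith
        then show ?thesis by simp
      qed
      with x xs cell have "x k \<le> a" "\<not> real i + 1 \<le> 2 ^ m * a" by auto
      moreover from this have "2 ^ m * x k \<le> 2 ^ m * a" by simp
      ultimately have "real i \<le> 2 ^ m * a" "2 ^ m * a < real i + 1" using fl by linarith+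
      then show ?thesis unfolding b_def by linarith
    qed
    then show "x \<in> {x \<in> space (cube n). dyadic_index m (x k) = b} \<union> {x \<in> space (cube n). dyadic_index m (x k) = 2 ^ m - 1}"
      using xs i0 unfolding i_def by blast
  qed
  show "\<exists>m F. measure (cube n) (sym_diff {x \<in> space (cube n). x k \<le> a} (cell_union n m F)) < e"
  proof (intro exI)
    let ?S = "\<lambda>b. {x \<in> space (cube n). dyadic_index m (x k) = b}"
    have "measure (cube n) (sym_diff {x \<in> space (cube n). x k \<le> a} (cell_union n m F))
        \<le> measure (cube n) (?S b \<union> ?S (2 ^ m - 1))"
      using sub measure_coordinate_index(1)[OF k] by (intro cube_prob.finite_measure_mono sets.Un) auto
    also have "\<dots> \<le> measure (cube n) (?S b) + measure (cube n) (?S (2 ^ m - 1))"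
      using measure_coordinate_index(1)[OF k] by (intro measure_Un_le) auto
    also have "\<dots> \<le> 1 / 2 ^ m + 1 / 2 ^ m"
      by (intro add_mono measure_coordinate_index(2)[OF k])
    finally show "measure (cube n) (sym_diff {x \<in> space (cube n). x k \<le> a} (cell_union n m F)) < e"
      using m by linarith
  qed
qed

text \<open>
  The coordinates are measurable with respect to the \<open>\<sigma>\<close>-algebra of approximable sets, by
  \<open>approximable_coordinate\<close>. Hence so is the identity as a map to the cube.
\<close>

lemma approximable_all:
  assumes "A \<in> sets (cube n)"
  shows "approximable n A"
proof -
  let ?A = "{A. approximable n A}"
  have sub: "?A \<subseteq> Pow (space (cube n))" using sets.sets_into_space by (force simp: approximable_def)
  have sa: "sigma_algebra (space (cube n)) ?A"
    unfolding sigma_algebra_iff2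
  proof (intro conjI ballI allI impI)
    show "?A \<subseteq> Pow (space (cube n))" by (rule sub)
    have "cell_union n 0 {} = {}" by (simp add: cell_union_def)
    then show "{} \<in> ?A" unfolding approximable_def by (auto intro!: exI[of _ "0::nat"] exI[of _ "{}"])
  qed (auto intro: approximable_Compl approximable_UN)
  define N where "N = sigma (space (cube n)) ?A"
  have N: "space N = space (cube n)" "sets N = ?A"
    using sub sigma_algebra.sigma_sets_eq[OF sa]
    by (simp_all add: N_def space_measure_of sets_measure_of)
  have "(\<lambda>x k. x k) \<in> N \<rightarrow>\<^sub>M cube n"
    unfolding cube_def
  proof (rule measurable_PiM_single')
    show "(\<lambda>x k. x k) \<in> space N \<rightarrow> (\<Pi>\<^sub>E k\<in>{1..n}. space unit_interval)"
      by (simp add: N space_cube)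
    fix k assume k: "k \<in> {1..n}"
    have "(\<lambda>x. x k) \<in> borel_measurable N"
      using approximable_coordinate[OF k] by (intro borel_measurableI_le) (simp add: N)
    moreover have "(\<lambda>x. x k) \<in> space N \<rightarrow> {0..1}" using k by (auto simp: N space_cube)
    ultimately show "(\<lambda>x. x k) \<in> N \<rightarrow>\<^sub>M unit_interval"
      unfolding unit_interval_def by (intro measurable_restrict_space2) auto
  qed
  from measurable_sets[OF this assms] have "A \<inter> space (cube n) \<in> ?A" by (simp add: N vimage_def)
  moreover have "A \<inter> space (cube n) = A" using sets.sets_into_space[OF assms] by auto
  ultimately show ?thesis by simp
qed

section \<open>The influence inequality\<close>

lemma abs_x_ln_x_le:
  fixes t :: real
  assumes "0 \<le> t" "t \<le> 1"
  shows "\<bar>t * ln t\<bar> \<le> 2 * sqrt t"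
proof (cases "t = 0")
  case False
  then have t: "t > 0" using assms by simp
  have "ln (1 / sqrt t) \<le> 1 / sqrt t - 1" using t by (intro ln_le_minus_one) simp
  moreover have "ln (1 / sqrt t) = - ln t / 2" using t by (simp add: ln_div ln_sqrt)
  ultimately have "- ln t \<le> 2 / sqrt t" by linarith
  then have "t * (- ln t) \<le> t * (2 / sqrt t)" using t by (intro mult_left_mono) auto
  also have "\<dots> = 2 * (t / sqrt t)" by simp
  also have "\<dots> = 2 * sqrt t" by (simp only: real_div_sqrt[OF assms(1)])
  finally show ?thesis using assms t by (simp add: abs_mult)
qed simp

text \<open>
  Continuity at \<open>0\<close>, where \<open>ln 0 = 0\<close>, is the only question, and \<open>abs_x_ln_x_le\<close> answers it.
\<close>

lemma continuous_on_x_ln_x: "continuous_on {0..1} (\<lambda>t::real. t * ln t)"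
  unfolding continuous_on_def
proof
  fix x :: real assume x: "x \<in> {0..1}"
  show "((\<lambda>t. t * ln t) \<longlongrightarrow> x * ln x) (at x within {0..1})"
  proof (cases "x = 0")
    case True
    have "((\<lambda>t::real. t * ln t) \<longlongrightarrow> 0) (at x within {0..1})"
    proof (rule Lim_null_comparison)
      show "\<forall>\<^sub>F t in at x within {0..1}. norm (t * ln t) \<le> 2 * sqrt t"
        using abs_x_ln_x_le by (auto simp: eventually_at_filter)
      have "((\<lambda>t. 2 * sqrt t) \<longlongrightarrow> 2 * sqrt x) (at x within {0..1})" by (intro tendsto_intros)
      then show "((\<lambda>t. 2 * sqrt t) \<longlongrightarrow> 0) (at x within {0..1})" using True by simp
    qed
    then show ?thesis using True by simp
  qed (intro tendsto_intros)
qed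

text \<open>
  The convention \<open>ln 0 = 0\<close> makes the formula valid at the endpoints as well.
\<close>

lemma Ent_eq: "t \<in> {0..1} \<Longrightarrow> Ent t = (- 1 / ln 2) * (t * ln t + (1 - t) * ln (1 - t))"
  by (cases "t = 0 \<or> t = 1") (auto simp: Ent_def log_def field_simps)

lemma continuous_on_Ent: "continuous_on {0..1} Ent"
proof -
  have "continuous_on {0..1} (\<lambda>t::real. (1 - t) * ln (1 - t))"
    by (rule continuous_on_compose2[OF continuous_on_x_ln_x, of _ "\<lambda>t. 1 - t"]) (auto intro!: continuous_intros)
  from continuous_on_mult_left[OF continuous_on_add[OF continuous_on_x_ln_x this]]
  have "continuous_on {0..1} (\<lambda>t::real. (- 1 / ln 2) * (t * ln t + (1 - t) * ln (1 - t)))" .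
  then show ?thesis by (rule continuous_on_cong[THEN iffD1, OF refl Ent_eq[symmetric], rotated])
qed

lemma Ent_nonneg: "0 \<le> Ent t"
proof (cases "0 < t \<and> t < 1")
  case True
  then have "t * log 2 t \<le> 0" "(1 - t) * log 2 (1 - t) \<le> 0"
    by (auto intro!: mult_nonneg_nonpos)
  then show ?thesis using True by (simp add: Ent_def)
qed (auto simp: Ent_def)

text \<open>
  Uniform continuity in a form that can be integrated: if \<open>s\<close> and \<open>t\<close> are at least \<open>d\<close> apart, the
  difference of the values is bounded by \<open>2 * B \<le> (2 * B / d) * \<bar>t - s\<bar>\<close>.
\<close>

lemma continuous_modulus_linear:
  fixes g :: "real \<Rightarrow> real"
  assumes g: "continuous_on {a..b} g" and e: "e > 0"
  shows "\<exists>C\<ge>0. \<forall>s\<in>{a..b}. \<forall>t\<in>{a..b}. g s \<le> g t + e + C * \<bar>t - s\<bar>"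
proof -
  have "bounded (g ` {a..b})" using g by (intro compact_imp_bounded compact_continuous_image) auto
  then obtain B where "\<forall>y\<in>g ` {a..b}. norm y \<le> B" unfolding bounded_iff by blast
  then have B: "\<bar>g t\<bar> \<le> B" if "t \<in> {a..b}" for t using that by auto
  have "uniformly_continuous_on {a..b} g" using g by (intro compact_uniformly_continuous) auto
  then obtain d where d: "d > 0" "\<And>s t. s \<in> {a..b} \<Longrightarrow> t \<in> {a..b} \<Longrightarrow> \<bar>t - s\<bar> < d \<Longrightarrow> \<bar>g t - g s\<bar> < e"
    using e unfolding uniformly_continuous_on_def dist_real_def by meson
  let ?C = "2 * \<bar>B\<bar> / d"
  have "g s \<le> g t + e + ?C * \<bar>t - s\<bar>" if s: "s \<in> {a..b}" and t: "t \<in> {a..b}" for s t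
  proof (cases "\<bar>t - s\<bar> < d")
    case True
    moreover have "0 \<le> ?C * \<bar>t - s\<bar>" using d(1) by simp
    ultimately show ?thesis using d(2)[OF s t True] by linarith
  next
    case False
    then have "?C * d \<le> ?C * \<bar>t - s\<bar>" using d(1) by (intro mult_left_mono) auto
    then have "2 * \<bar>B\<bar> \<le> ?C * \<bar>t - s\<bar>" using d(1) by simp
    then show ?thesis using B[OF s] B[OF t] e by linarith
  qed
  moreover have "?C \<ge> 0" using d(1) by simp
  ultimately show ?thesis by blast
qed

lemma measurable_Ent: "Ent \<in> borel_measurable borel"
  unfolding Ent_def[abs_def] by measurable

text \<open>
  A concave function is continuous in the open interval, but it may jump at the endpoints.
\<close>

lemma concave_on_Icc_measurable:
  fixes h :: "real \<Rightarrow> real"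
  assumes "concave_on {0..1} h"
  obtains h' where "h' \<in> borel_measurable borel" "\<And>t. t \<in> {0..1} \<Longrightarrow> h' t = h t"
proof
  define g where "g t = (if t \<in> {0<..<1} then h t else 0)" for t
  define h' where "h' t = (if t = 0 then h 0 else if t = 1 then h 1 else g t)" for t
  have "convex_on {0<..<1} (\<lambda>t. - h t)"
    using assms unfolding concave_on_def by (rule convex_on_subset) auto
  then have "continuous_on {0<..<1} (\<lambda>t. - h t)" by (intro convex_on_continuous) auto
  then have c: "continuous_on {0<..<1} h" using continuous_on_minus by fastforce
  have [measurable]: "g \<in> borel_measurable borel"
    unfolding g_def[abs_def] by (rule borel_measurable_continuous_on_if[OF _ c]) auto
  show "h' \<in> borel_measurable borel"
    unfolding h'_def[abs_def] by measurable
  show "h' t = h t" if "t \<in> {0..1}" for t using that by (auto simp: h'_def g_def)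
qed

lemma dyadic_approximation:
  fixes e :: real
  assumes f: "f \<in> space (cube n) \<rightarrow> {0, 1}" "f \<in> borel_measurable (cube n)" and e: "e > 0"
  obtains m F where "F \<subseteq> grid {1..n} (2 ^ m)"
    "(LINT x|cube n. \<bar>f x - of_bool (cell n m x \<in> F)\<bar>) < e"
proof -
  define A where "A = {x \<in> space (cube n). f x = 1}"
  have "A \<in> sets (cube n)" unfolding A_def using f(2) by measurable
  then obtain m F where mF: "measure (cube n) (sym_diff A (cell_union n m F)) < e"
    using approximable_all[of A n] e unfolding approximable_def by blast
  let ?D = "sym_diff A (cell_union n m F)"
  have D: "?D \<in> sets (cube n)" using \<open>A \<in> sets (cube n)\<close> sets_cell_union by auto
  have "(LINT x|cube n. \<bar>f x - of_bool (cell n m x \<in> F \<inter> grid {1..n} (2 ^ m))\<bar>) = (LINT x|cube n. indicator ?D x)"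
    by (rule Bochner_Integration.integral_cong)
       (use funcset_mem[OF f(1)] cell_in_grid[of n m] in \<open>force simp: A_def cell_union_def indicator_def\<close>)+
  also have "\<dots> = measure (cube n) ?D" using D by simp
  also have "\<dots> < e" by (rule mF)
  finally show ?thesis by (intro that[of "F \<inter> grid {1..n} (2 ^ m)" m]) auto
qed

lemma fiber_mean_cell:
  assumes k: "k \<in> {1..n}"
  shows "(LINT t|unit_interval. of_bool (cell n m (x(k := t)) \<in> F)) = fiber_count (2 ^ m) F k (cell n m x) / 2 ^ m"
proof -
  have "(LINT t|unit_interval. of_bool (cell n m (x(k := t)) \<in> F))
      = (\<Sum>a<2 ^ m. of_bool ((cell n m x)(k := a) \<in> F)) / (2 ^ m :: real)"
    unfolding cell_upd[OF k] by (rule integral_dyadic_index)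
  also have "(\<Sum>a<2 ^ m. of_bool ((cell n m x)(k := a) \<in> F)) = real (fiber_count (2 ^ m) F k (cell n m x))"
    by (simp add: fiber_count_def sum.If_cases of_bool_def Int_def)
  finally show ?thesis .
qed

lemma measurable_cell_mem: "(\<lambda>x. of_bool (cell n m x \<in> F) :: real) \<in> borel_measurable (cube n)"
proof -
  have "(\<lambda>x. indicator (cell_union n m F) x :: real) \<in> borel_measurable (cube n)"
    using sets_cell_union by (rule borel_measurable_indicator)
  also have "?this \<longleftrightarrow> ?thesis"
    by (rule measurable_cong) (auto simp: cell_union_def indicator_def)
  finally show ?thesis .
qed

text \<open>
  If \<open>g\<close> is the indicator of a union of cells and \<open>\<delta> = \<bar>f - g\<bar>\<close>, then the fibre means of \<open>f\<close> and \<open>g\<close> differ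
  by at most the fibre mean of \<open>\<delta>\<close>. By \<open>continuous_modulus_linear\<close> the influences differ by at most \<open>e / 2\<close>
  plus a constant times the mean of \<open>\<delta>\<close>, which \<open>\<epsilon>\<close> makes at most \<open>e / 2\<close>.
\<close>

lemma grid_entropy_approximation:
  assumes f: "f \<in> space (cube n) \<rightarrow> {0, 1}" "f \<in> borel_measurable (cube n)" and e: "e > 0"
  obtains m F where "F \<subseteq> grid {1..n} (2 ^ m)"
    "\<bar>(LINT x|cube n. f x) - real (card F) / real (2 ^ m) ^ n\<bar> \<le> e"
    "\<And>k. k \<in> {1..n} \<Longrightarrow>
      (\<Sum>x\<in>grid {1..n} (2 ^ m). Ent (fiber_count (2 ^ m) F k x / 2 ^ m)) / real (2 ^ m) ^ n
      \<le> h_influence Ent n f k + e"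
proof -
  obtain C where C: "C \<ge> 0" and mod: "\<And>s t. s \<in> {0..1} \<Longrightarrow> t \<in> {0..1} \<Longrightarrow> Ent s \<le> Ent t + e / 2 + C * \<bar>t - s\<bar>"
    using continuous_modulus_linear[OF continuous_on_Ent, of "e / 2"] e by auto
  define \<epsilon> where "\<epsilon> = min e (e / (2 * (C + 1)))"
  have \<epsilon>: "\<epsilon> > 0" "\<epsilon> \<le> e" "C * \<epsilon> \<le> e / 2"
  proof -
    show "\<epsilon> > 0" "\<epsilon> \<le> e" using e C by (auto simp: \<epsilon>_def)
    have "C * \<epsilon> \<le> C * (e / (2 * (C + 1)))" using C by (intro mult_left_mono) (auto simp: \<epsilon>_def)
    also have "\<dots> \<le> e / 2" using C e by (simp add: field_simps)
    finally show "C * \<epsilon> \<le> e / 2" .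
  qed
  obtain m F where F: "F \<subseteq> grid {1..n} (2 ^ m)"
    and close: "(LINT x|cube n. \<bar>f x - of_bool (cell n m x \<in> F)\<bar>) < \<epsilon>"
    using dyadic_approximation[OF f \<epsilon>(1)] .
  define g where "g x = (of_bool (cell n m x \<in> F) :: real)" for x
  define \<delta> where "\<delta> x = \<bar>f x - g x\<bar>" for x
  have g: "g \<in> borel_measurable (cube n)" unfolding g_def[abs_def] by (rule measurable_cell_mem)
  have \<delta>: "\<delta> \<in> borel_measurable (cube n)" unfolding \<delta>_def[abs_def] using f(2) g by measurable
  have f01: "f x \<in> {0..1}" and g01: "g x \<in> {0..1}" and \<delta>01: "\<delta> x \<in> {0..1}" if "x \<in> space (cube n)" for x
    using funcset_mem[OF f(1) that] by (auto simp: g_def \<delta>_def)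
  note int = cube_prob.integral_in_Icc(1)[OF f(2) f01] cube_prob.integral_in_Icc(1)[OF g g01]
    cube_prob.integral_in_Icc(1)[OF \<delta> \<delta>01]
  have mean_g: "(LINT x|cube n. g x) = real (card F) / real (2 ^ m) ^ n"
  proof -
    have "(LINT x|cube n. g x) = (\<Sum>i\<in>grid {1..n} (2 ^ m). of_bool (i \<in> F) * 1) / real (2 ^ m) ^ n"
      unfolding g_def mult_1_right by (rule integral_cell)
    also have "(\<Sum>i\<in>grid {1..n} (2 ^ m). of_bool (i \<in> F) * 1) = real (card F)"
      by (subst sum_indicator_grid[OF _ F]) auto
    finally show ?thesis .
  qed
  have "\<bar>(LINT x|cube n. f x) - (LINT x|cube n. g x)\<bar> = \<bar>LINT x|cube n. f x - g x\<bar>"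
    using int by simp
  also have "\<dots> \<le> (LINT x|cube n. \<delta> x)" unfolding \<delta>_def by (rule integral_abs_bound)
  also have "\<dots> \<le> e" using close \<epsilon>(2) by (simp add: \<delta>_def g_def)
  finally have mean: "\<bar>(LINT x|cube n. f x) - real (card F) / real (2 ^ m) ^ n\<bar> \<le> e"
    unfolding mean_g .
  have infl: "(\<Sum>x\<in>grid {1..n} (2 ^ m). Ent (fiber_count (2 ^ m) F k x / 2 ^ m)) / real (2 ^ m) ^ n
      \<le> h_influence Ent n f k + e" if k: "k \<in> {1..n}" for k
  proof -
    define fk where "fk x = (LINT t|unit_interval. f (x(k := t)))" for x
    define gk where "gk x = (LINT t|unit_interval. g (x(k := t)))" for x
    define \<delta>k where "\<delta>k x = (LINT t|unit_interval. \<delta> (x(k := t)))" for x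
    have meas: "fk \<in> borel_measurable (cube n)" "gk \<in> borel_measurable (cube n)" "\<delta>k \<in> borel_measurable (cube n)"
      unfolding fk_def[abs_def] gk_def[abs_def] \<delta>k_def[abs_def]
      by (intro measurable_fiber_integral[OF k] f(2) g \<delta>)+
    have k01: "fk x \<in> {0..1} \<and> gk x \<in> {0..1} \<and> \<delta>k x \<in> {0..1} \<and> \<bar>fk x - gk x\<bar> \<le> \<delta>k x"
      if x: "x \<in> space (cube n)" for x
    proof -
      have sp: "t \<in> space unit_interval \<Longrightarrow> x(k := t) \<in> space (cube n)" for t
        using cube_upd[OF x k] by simp
      note 1 = unit_interval.integral_in_Icc[OF measurable_fiber[OF k f(2) x] f01[OF sp]]
      note 2 = unit_interval.integral_in_Icc[OF measurable_fiber[OF k g x] g01[OF sp]]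
      note 3 = unit_interval.integral_in_Icc[OF measurable_fiber[OF k \<delta> x] \<delta>01[OF sp]]
      have "\<bar>fk x - gk x\<bar> = \<bar>LINT t|unit_interval. f (x(k := t)) - g (x(k := t))\<bar>"
        unfolding fk_def gk_def using 1(1) 2(1) by simp
      also have "\<dots> \<le> \<delta>k x" unfolding \<delta>k_def \<delta>_def by (rule integral_abs_bound)
      finally show ?thesis using 1(2) 2(2) 3(2) by (simp add: fk_def gk_def \<delta>k_def)
    qed
    have int_\<delta>k: "integrable (cube n) \<delta>k"
      by (rule cube_prob.integral_in_Icc(1)[OF meas(3)]) (use k01 in blast)
    have EntB: "\<exists>B. \<forall>t\<in>{0..1}. Ent t \<in> {0..B}"
    proof -
      have "bounded (Ent ` {0..1})"
        by (intro compact_imp_bounded compact_continuous_image continuous_on_Ent) auto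
      then show ?thesis using Ent_nonneg by (auto simp: bounded_iff abs_le_iff)
    qed
    then obtain B where B: "\<And>t. t \<in> {0..1} \<Longrightarrow> Ent t \<in> {0..B}" by blast
    have int_Ent: "integrable (cube n) (\<lambda>x. Ent (fk x))" "integrable (cube n) (\<lambda>x. Ent (gk x))"
      by (rule cube_prob.integral_in_Icc(1)[OF measurable_compose[OF meas(1) measurable_Ent]], use k01 B in blast)
         (rule cube_prob.integral_in_Icc(1)[OF measurable_compose[OF meas(2) measurable_Ent]], use k01 B in blast)
    have "(\<Sum>x\<in>grid {1..n} (2 ^ m). Ent (fiber_count (2 ^ m) F k x / 2 ^ m)) / real (2 ^ m) ^ n
        = (LINT x|cube n. Ent (fiber_count (2 ^ m) F k (cell n m x) / 2 ^ m))"
      by (rule integral_cell[symmetric])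
    also have "\<dots> = (LINT x|cube n. Ent (gk x))"
      unfolding gk_def g_def fiber_mean_cell[OF k] ..
    also have "\<dots> \<le> (LINT x|cube n. Ent (fk x) + e / 2 + C * \<delta>k x)"
    proof (rule integral_mono)
      show "integrable (cube n) (\<lambda>x. Ent (fk x) + e / 2 + C * \<delta>k x)"
        using int_Ent int_\<delta>k by simp
      fix x assume x: "x \<in> space (cube n)"
      have "Ent (gk x) \<le> Ent (fk x) + e / 2 + C * \<bar>fk x - gk x\<bar>"
        using k01[OF x] by (intro mod) auto
      also have "C * \<bar>fk x - gk x\<bar> \<le> C * \<delta>k x" using k01[OF x] C by (intro mult_left_mono) auto
      finally show "Ent (gk x) \<le> Ent (fk x) + e / 2 + C * \<delta>k x" by simp
    qed (rule int_Ent)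
    also have "\<dots> = (LINT x|cube n. Ent (fk x)) + e / 2 + C * (LINT x|cube n. \<delta>k x)"
      using int_Ent int_\<delta>k by (simp add: cube_prob.prob_space)
    also have "(LINT x|cube n. \<delta>k x) = (LINT x|cube n. \<delta> x)"
      unfolding \<delta>k_def by (rule cube_integral_resample[OF k \<delta> \<delta>01])
    also have "C * (LINT x|cube n. \<delta> x) \<le> C * \<epsilon>"
      using close C by (intro mult_left_mono) (auto simp: \<delta>_def g_def)
    also have "\<dots> \<le> e / 2" by (rule \<epsilon>(3))
    finally show ?thesis by (simp add: h_influence_def fiber_def fk_def)
  qed
  show ?thesis by (rule that[OF F mean infl])
qed

text \<open>
  The bound for grids, applied to approximations of \<open>f\<close>. Replacing \<open>p\<close> by the density \<open>q\<close> of the grid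
  set costs at most \<open>\<bar>p - q\<bar>\<close>, because \<open>t * (1 - t)\<close> has slope at most one on \<open>[0, 1]\<close>.
\<close>

lemma Ent_influence_bound:
  assumes f: "f \<in> space (cube n) \<rightarrow> {0, 1}" "f \<in> borel_measurable (cube n)"
    and n: "n \<ge> 2" and J: "\<And>k. k \<in> {1..n} \<Longrightarrow> h_influence Ent n f k \<le> J"
  defines "p \<equiv> (LINT x|cube n. f x)"
  shows "1/36 * (p * (1 - p)) * (log 2 (real n) / real n) \<le> J"
proof -
  define R where "R = log 2 (real n) / real n"
  have R: "R \<ge> 0" unfolding R_def using n by (intro divide_nonneg_nonneg) auto
  have p01: "p \<in> {0..1}" unfolding p_def
    by (rule cube_prob.integral_in_Icc(2)[OF f(2)]) (use funcset_mem[OF f(1)] in force)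
  have approx: "1/36 * (p * (1 - p)) * R \<le> J + (1 + R / 36) * e" if e: "e > 0" for e
  proof -
    obtain m F where F: "F \<subseteq> grid {1..n} (2 ^ m)"
      and q: "\<bar>p - real (card F) / real (2 ^ m) ^ n\<bar> \<le> e"
      and infl: "\<And>k. k \<in> {1..n} \<Longrightarrow>
        (\<Sum>x\<in>grid {1..n} (2 ^ m). Ent (fiber_count (2 ^ m) F k x / 2 ^ m)) / real (2 ^ m) ^ n
        \<le> h_influence Ent n f k + e"
      using grid_entropy_approximation[OF f e] unfolding p_def by metis
    define q where "q = real (card F) / real (2 ^ m) ^ n"
    have KKL: "4 * (q * (1 - q)) \<le> real n * (6 * (J + e)) * (3 ^ d * sqrt (6 * (J + e)) + 1 / real (d + 1))" for d
      using grid_influence_inequality[of "{1..n}" F m "J + e" d] F infl J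
      unfolding q_def by fastforce
    have "0 \<le> (\<Sum>x\<in>grid {1..n} (2 ^ m). Ent (fiber_count (2 ^ m) F 1 x / 2 ^ m)) / real (2 ^ m) ^ n"
      by (intro divide_nonneg_nonneg sum_nonneg Ent_nonneg) simp
    also have "\<dots> \<le> J + e" using infl[of 1] J[of 1] n by fastforce
    finally have J0: "0 \<le> J + e" .
    have "q * (1 - q) \<le> 1/4"
      using zero_le_power2[of "q - 1/2"] by (simp add: power2_eq_square algebra_simps)
    then have main: "1/36 * (q * (1 - q)) * R \<le> J + e"
      unfolding R_def using log_bound_of_KKL[OF n _ J0 KKL] by blast
    have "card F \<le> card (grid {1..n} (2 ^ m))" by (rule card_mono[OF finite_grid F])
    also have "\<dots> = (2 ^ m) ^ n" by (simp add: card_PiE)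
    finally have "real (card F) \<le> real ((2 ^ m) ^ n)" by (rule of_nat_mono)
    then have "0 \<le> q" "q \<le> 1" unfolding q_def by (simp_all add: divide_le_eq)
    have dist: "1/36 * (u + e) * R = 1/36 * u * R + R / 36 * e" for u by (simp add: algebra_simps)
    have "p * (1 - p) - q * (1 - q) = (p - q) * (1 - p - q)" by (simp add: algebra_simps)
    also have "\<dots> \<le> \<bar>p - q\<bar> * \<bar>1 - p - q\<bar>" by (metis abs_ge_self abs_mult)
    also have "\<dots> \<le> e * 1"
      using q p01 \<open>0 \<le> q\<close> \<open>q \<le> 1\<close> unfolding q_def[symmetric] by (intro mult_mono) auto
    finally have "p * (1 - p) \<le> q * (1 - q) + e" by simp
    then have "1/36 * (p * (1 - p)) * R \<le> 1/36 * (q * (1 - q) + e) * R"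
      using R by (intro mult_right_mono) auto
    also have "\<dots> = 1/36 * (q * (1 - q)) * R + R / 36 * e" by (rule dist)
    also have "\<dots> \<le> J + e + R / 36 * e" using main by simp
    also have "\<dots> = J + (1 + R / 36) * e" by (simp add: algebra_simps)
    finally show ?thesis .
  qed
  have "1/36 * (p * (1 - p)) * R \<le> J"
  proof (rule field_le_epsilon)
    fix e :: real assume e: "e > 0"
    have "(1 + R / 36) * (e / (1 + R / 36)) = e" using R by simp
    moreover have "e / (1 + R / 36) > 0" using e R by (intro divide_pos_pos) auto
    ultimately show "1/36 * (p * (1 - p)) * R \<le> J + e" using approx[of "e / (1 + R / 36)"] by simp
  qed
  then show ?thesis unfolding R_def .
qed

text \<open>
  The inequality of the integrands is preserved because both integrals exist; for \<open>h\<close> this is where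
  concavity enters, through measurability.
\<close>

lemma Ent_influence_le:
  assumes h: "h \<in> {0..1} \<rightarrow> {0..1}" "concave_on {0..1} h" "\<And>t. t \<in> {0..1} \<Longrightarrow> Ent t \<le> h t"
    and f: "f \<in> space (cube n) \<rightarrow> {0, 1}" "f \<in> borel_measurable (cube n)" and k: "k \<in> {1..n}"
  shows "h_influence Ent n f k \<le> h_influence h n f k"
proof -
  define fk where "fk x = (LINT t|unit_interval. f (x(k := t)))" for x
  have fk: "fk \<in> borel_measurable (cube n)"
    unfolding fk_def[abs_def] by (rule measurable_fiber_integral[OF k f(2)])
  have fk01: "fk x \<in> {0..1}" if x: "x \<in> space (cube n)" for x
    unfolding fk_def
    by (rule unit_interval.integral_in_Icc(2)[OF measurable_fiber[OF k f(2) x]])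
       (use funcset_mem[OF f(1) cube_upd[OF x k]] in force)
  obtain h' where h': "h' \<in> borel_measurable borel" "\<And>t. t \<in> {0..1} \<Longrightarrow> h' t = h t"
    by (rule concave_on_Icc_measurable[OF h(2)]) blast
  have "(LINT x|cube n. Ent (fk x)) \<le> (LINT x|cube n. h' (fk x))"
  proof (rule integral_mono)
    have h01: "h t \<in> {0..1}" if "t \<in> {0..1}" for t using h(1) that by auto
    have b: "Ent (fk x) \<in> {0..1}" "h' (fk x) \<in> {0..1}" "Ent (fk x) \<le> h' (fk x)" if "x \<in> space (cube n)" for x
      using fk01[OF that] h01[of "fk x"] h(3)[of "fk x"] h'(2)[of "fk x"] Ent_nonneg[of "fk x"] by auto
    show "integrable (cube n) (\<lambda>x. Ent (fk x))"
      by (rule cube_prob.integral_in_Icc(1)[OF measurable_compose[OF fk measurable_Ent] b(1)])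
    show "integrable (cube n) (\<lambda>x. h' (fk x))"
      by (rule cube_prob.integral_in_Icc(1)[OF measurable_compose[OF fk h'(1)] b(2)])
    show "Ent (fk x) \<le> h' (fk x)" if "x \<in> space (cube n)" for x using b(3)[OF that] .
  qed
  also have "\<dots> = (LINT x|cube n. h (fk x))"
    by (rule Bochner_Integration.integral_cong) (use fk01 h'(2) in auto)
  finally show ?thesis by (simp add: h_influence_def fiber_def fk_def)
qed

theorem theorem2:
  "\<exists>c::real. c > 0 \<and>
    (\<forall>h :: real \<Rightarrow> real.
      h \<in> {0..1} \<rightarrow> {0..1} \<longrightarrow> concave_on {0..1} h \<longrightarrow> (\<forall>t\<in>{0..1}. h t \<ge> Ent t) \<longrightarrow>
      (\<forall>n::nat. n \<ge> 1 \<longrightarrow>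
        (\<forall>(f :: (nat \<Rightarrow> real) \<Rightarrow> real) (p :: real).
          f \<in> space (cube n) \<rightarrow> {0, 1} \<longrightarrow> f \<in> borel_measurable (cube n) \<longrightarrow>
          (LINT x|cube n. f x) = p \<longrightarrow>
          (\<exists>k\<in>{1..n}. h_influence h n f k \<ge> c * p * (1 - p) * (log 2 (real n) / real n)))))"
proof (intro exI[of _ "1/36"] conjI allI impI)
  fix h :: "real \<Rightarrow> real" and n :: nat and f :: "(nat \<Rightarrow> real) \<Rightarrow> real" and p :: real
  assume h: "h \<in> {0..1} \<rightarrow> {0..1}" "concave_on {0..1} h" "\<forall>t\<in>{0..1}. h t \<ge> Ent t"
    and n: "n \<ge> 1" and f: "f \<in> space (cube n) \<rightarrow> {0, 1}" "f \<in> borel_measurable (cube n)"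
    and p: "(LINT x|cube n. f x) = p"
  have le: "h_influence Ent n f k \<le> h_influence h n f k" if "k \<in> {1..n}" for k
    by (rule Ent_influence_le[OF h(1,2) _ f that]) (use h(3) in auto)
  show "\<exists>k\<in>{1..n}. h_influence h n f k \<ge> 1/36 * p * (1 - p) * (log 2 (real n) / real n)"
  \<comment> \<open>For \<open>n = 1\<close> the logarithm vanishes.\<close>
  proof (cases "n = 1")
    case True
    have "0 \<le> h_influence Ent n f 1"
      unfolding h_influence_def by (intro Bochner_Integration.integral_nonneg Ent_nonneg)
    then show ?thesis using le[of 1] True by (intro bexI[of _ 1]) auto
  next
    case False
    let ?J = "Max (h_influence Ent n f ` {1..n})"
    have "?J \<in> h_influence Ent n f ` {1..n}" using n by (intro Max_in) auto
    then obtain k where k: "k \<in> {1..n}" "h_influence Ent n f k = ?J" by auto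
    have "1/36 * (p * (1 - p)) * (log 2 (real n) / real n) \<le> ?J"
      unfolding p[symmetric] using False n by (intro Ent_influence_bound[OF f]) auto
    also have "\<dots> \<le> h_influence h n f k" unfolding k(2)[symmetric] by (rule le[OF k(1)])
    finally show ?thesis using k(1) by (intro bexI[of _ k]) (auto simp: mult.assoc)
  qed
qed simp

end
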